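(* Let $\mathcal G_n$ be a set of graphs on $n$ vertices and $d=d(n)\ge2$. Suppose that $d<\log^J n$ for some fixed $J$, and that for some positive constants $\delta$ and $a_1,\dots,a_5$, for every $G_n\in\mathcal G_n$ there exists $X(G_n)\subseteq V(G_n)$ with $|X(G_n)|=O(\sqrt n)$ such that the following hold. (i) For all $v\in V(G_n)\setminus X(G_n)$, all $r\ge1$ with $d^r<n^{1/2+\delta}$, all $r'\ge1$ with $d^{r'}<n^{1/2+\delta}$, and all $V'\subseteq N(v,r)\setminus X(G_n)$ with $|V'|=k$ such that $kd^{r'}\le n/\log^J n$, we have $a_1kd^{r'}\le |S(V',r')|\le a_2kd^{r'}$. (In particular, with $k=1$, $a_1d^{r'}\le|S(v,r')|\le a_2d^{r'}$.) (ii) Let $r$ satisfy $n^{1/4-\delta}<(d+1)d^r<n^{1/4+\delta}$ and let $r'$ satisfy $n^{1/4-\delta}<(d+1)d^{r'}<n^{1/4+\delta}$. Let $v\in V(G_n)\setminus X(G_n)$, $A\subseteq S(v,r)\setminus X(G_n)$, and $U=\bigcup_{a\in A}S(a,r')$, with $|A|>n^{1/4-\delta}$ and $d^{r+r'}<a_3n/|U|$. Then there exists a set $Q$ such that $|S(a,r')\cap Q|<n^{1/4-2\delta}$ for all $a\in A$, and such that $U\setminus Q$ is $(r+r'+1,a_4,a_5)$-accessible. (iii) $G_n-X(G_n)$ is contained in a single connected component of $G_n$. Then $c(G_n)=O(\sqrt n)$.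
   Context: $\log$ is natural. For a vertex set $V'$ and $r\ge0$, $S(V',r)$ is the set of vertices at distance exactly $r$ from $V'$ and $N(V',r)$ the set of vertices at distance at most $r$ from $V'$; for a single vertex $v$, $S(v,r)=S(\{v\},r)$ and $N(v,r)=N(\{v\},r)$. A subset $U\subseteq V(G)$ is $(t,c_1,c_2)$-accessible if there is a family $\{W(w):w\in U\}$ of pairwise disjoint subsets of $V(G)$ such that $W(w)\subseteq N(w,t)$ and $|W(w)|\ge c_1\min\{d^t, c_2n/|U|\}$ for each $w\in U$. The $O(\cdot)$ bounds are uniform over $G_n\in\mathcal G_n$ as $n\to\infty$. The cop number $c(G)$ is the minimum number of cops that can guarantee capture of the robber in the game of Cops and Robbers on $G$ (cops choose initial vertices, then the robber; then cops and robber alternately move along an edge or stay put, with full information; cops win if a cop occupies the robber's vertex). *)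

theory Defs
  imports Complex_Main
begin

definition graph_on :: "nat \<Rightarrow> (nat \<Rightarrow> nat \<Rightarrow> bool) \<Rightarrow> bool" where
  "graph_on n E \<longleftrightarrow> (\<forall>x y. E x y \<longrightarrow> x < n \<and> y < n \<and> x \<noteq> y \<and> E y x)"

fun nbhd :: "(nat \<Rightarrow> nat \<Rightarrow> bool) \<Rightarrow> nat set \<Rightarrow> nat \<Rightarrow> nat set" where
  "nbhd E V' 0 = V'"
| "nbhd E V' (Suc r) = nbhd E V' r \<union> {y. \<exists>x\<in>nbhd E V' r. E x y}"

fun sphere :: "(nat \<Rightarrow> nat \<Rightarrow> bool) \<Rightarrow> nat set \<Rightarrow> nat \<Rightarrow> nat set" where
  "sphere E V' 0 = V'"
| "sphere E V' (Suc r) = nbhd E V' (Suc r) - nbhd E V' r"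

definition accessible ::
  "(nat \<Rightarrow> nat \<Rightarrow> bool) \<Rightarrow> nat \<Rightarrow> real \<Rightarrow> nat set \<Rightarrow> nat \<Rightarrow> real \<Rightarrow> real \<Rightarrow> bool" where
  "accessible E n d U t c1 c2 \<longleftrightarrow>
     (\<exists>W :: nat \<Rightarrow> nat set.
        (\<forall>w1\<in>U. \<forall>w2\<in>U. w1 \<noteq> w2 \<longrightarrow> W w1 \<inter> W w2 = {}) \<and>
        (\<forall>w\<in>U. W w \<subseteq> {..<n} \<and> W w \<subseteq> nbhd E {w} t \<and>
                 real (card (W w)) \<ge> c1 * min (d ^ t) (c2 * real n / real (card U))))"

text \<open>Cops and Robbers. Cops' positions are a list (one entry per cop).
 cw_cops E cs r: cops at cs, robber at r, cops to move: cops can force capture.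
 cw_robber E cs r: same with robber to move.\<close>
inductive cw_cops :: "(nat \<Rightarrow> nat \<Rightarrow> bool) \<Rightarrow> nat list \<Rightarrow> nat \<Rightarrow> bool"
  and cw_robber :: "(nat \<Rightarrow> nat \<Rightarrow> bool) \<Rightarrow> nat list \<Rightarrow> nat \<Rightarrow> bool"
  for E :: "nat \<Rightarrow> nat \<Rightarrow> bool" where
  cops_caught: "r \<in> set cs \<Longrightarrow> cw_cops E cs r"
| cops_move: "list_all2 (\<lambda>c c'. c' = c \<or> E c c') cs cs' \<Longrightarrow> cw_robber E cs' r \<Longrightarrow> cw_cops E cs r"
| robber_caught: "r \<in> set cs \<Longrightarrow> cw_robber E cs r"
| robber_move: "(\<And>r'. r' = r \<or> E r r' \<Longrightarrow> cw_cops E cs r') \<Longrightarrow> cw_robber E cs r"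

definition cops_win :: "nat \<Rightarrow> (nat \<Rightarrow> nat \<Rightarrow> bool) \<Rightarrow> nat \<Rightarrow> bool" where
  "cops_win n E k \<longleftrightarrow> (\<exists>cs. length cs = k \<and> set cs \<subseteq> {..<n} \<and> (\<forall>r<n. cw_cops E cs r))"

definition cop_number :: "nat \<Rightarrow> (nat \<Rightarrow> nat \<Rightarrow> bool) \<Rightarrow> nat" where
  "cop_number n E = (LEAST k. cops_win n E k)"

end

theory Submission
  imports Defs "HOL-Real_Asymp.Real_Asymp"
begin

text \<open>One team of cops occupies \<open>X\<close> throughout, and a cleaning team of about \<open>\<surd>n\<close> cops always
  marches towards all the vertices of the ball in which the robber currently is, so that he
  cannot stay in it for ever.

  The other teams are random and fence the robber in. At stage \<open>k\<close> the robber is at the centre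
  of a ball of radius about \<open>log_d (n^(1/4))\<close> whose boundary is fenced except for a set \<open>A\<close>
  containing at most the fraction \<open>16^-k\<close> of it. A fresh team of order \<open>2^-k \<surd>n\<close> random cops sets out
  at once to fence the spheres of radius \<open>r'\<close> around all \<open>a \<in> A\<close>. Because \<open>A\<close> is small, \<open>r'\<close> can be
  chosen so large that the accessible sets \<open>W(w)\<close> have order \<open>4^k \<surd>n\<close>; hence a given \<open>w\<close> has no cop in
  its set with probability at most \<open>exp (- C 2^k)\<close>, and since the \<open>W(w)\<close> are disjoint at most a
  fraction \<open>16^-(k+1)\<close> of each sphere stays unfenced except with probability
  \<open>exp (- n^(1/8))\<close>. This beats the union bound over the at most \<open>n^(k+2)\<close> possible histories. The team sizes form
  a geometric series.

  After logarithmically many stages \<open>|A|\<close> is a power of \<open>n\<close> below \<open>n^(1/4)\<close>. Then a last team of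
  \<open>\<surd>n\<close> random cops moves to distance slightly more than \<open>log_d \<surd>n\<close>, and Hall's condition, which
  follows from the expansion property (i), lets it fence everything. Probabilities are
  expressed by counting lists of starting positions.\<close>

section \<open>Balls, spheres and teams of cops\<close>

lemma nbhd_mono_radius: "s \<le> t \<Longrightarrow> nbhd E S s \<subseteq> nbhd E S t"
  by (induction t) (auto simp: le_Suc_eq)

lemma nbhd_subset:
  assumes "graph_on n E" "S \<subseteq> {..<n}"
  shows "nbhd E S t \<subseteq> {..<n}"
  using assms by (induction t) (auto simp: graph_on_def)

lemma nbhd_UN: "nbhd E S t = (\<Union>v\<in>S. nbhd E {v} t)"
  by (induction t) auto

lemma nbhd_trans: "y \<in> nbhd E S s \<Longrightarrow> z \<in> nbhd E {y} t \<Longrightarrow> z \<in> nbhd E S (s + t)"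
proof (induction t arbitrary: z)
  case (Suc t)
  then show ?case by (cases "z \<in> nbhd E {y} t") auto
qed simp

text \<open>The recursion of \<open>nbhd\<close> adds a last edge, whereas a cop walking towards
  \<open>w\<close> needs the first edge of its path.\<close>

lemma nbhd_SucE:
  assumes "w \<in> nbhd E {c} (Suc t)"
  obtains c' where "c' = c \<or> E c c'" "w \<in> nbhd E {c'} t"
proof -
  have "\<exists>c'. (c' = c \<or> E c c') \<and> w \<in> nbhd E {c'} t"
    using assms
  proof (induction t arbitrary: w)
    case (Suc t)
    show ?case
    proof (cases "w \<in> nbhd E {c} (Suc t)")
      case True
      then show ?thesis using Suc.IH by auto
    next
      case False
      then obtain x where "x \<in> nbhd E {c} (Suc t)" "E x w" using Suc.prems by auto
      then show ?thesis using Suc.IH[of x] by auto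
    qed
  qed auto
  then show ?thesis using that by blast
qed

lemma nbhd_sym:
  assumes "graph_on n E" "w \<in> nbhd E {v} t"
  shows "v \<in> nbhd E {w} t"
  using assms(2)
proof (induction t arbitrary: w)
  case (Suc t)
  show ?case
  proof (cases "w \<in> nbhd E {v} t")
    case False
    then obtain x where x: "x \<in> nbhd E {v} t" "E x w" using Suc.prems by auto
    have "E w x" using x assms(1) by (auto simp: graph_on_def)
    then have "x \<in> nbhd E {w} 1" by auto
    then show ?thesis using nbhd_trans[of x E "{w}" 1 v t] Suc.IH[OF x(1)] by simp
  qed (use Suc.IH in auto)
qed auto

lemma rtranclp_nbhd:
  assumes "E\<^sup>*\<^sup>* u w"
  shows "\<exists>t. w \<in> nbhd E {u} t"
  using assms
proof induction
  case base
  then show ?case using nbhd.simps(1) by blast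
next
  case (step y z)
  then obtain t where "y \<in> nbhd E {u} t" by blast
  then have "z \<in> nbhd E {u} (Suc t)" using step by auto
  then show ?case by blast
qed

lemma uniform_nbhd_radius:
  "\<exists>L. \<forall>u<n. \<forall>w<n. E\<^sup>*\<^sup>* u w \<longrightarrow> w \<in> nbhd E {u} L" for n :: nat
proof -
  define f where "f = (\<lambda>(u, w). SOME t. w \<in> nbhd E {u} t)"
  have "w \<in> nbhd E {u} (Max (f ` ({..<n} \<times> {..<n})))" if "u < n" "w < n" "E\<^sup>*\<^sup>* u w" for u w
  proof -
    have "w \<in> nbhd E {u} (f (u, w))"
      unfolding f_def using someI_ex[OF rtranclp_nbhd[OF that(3)]] by simp
    moreover have "f (u, w) \<le> Max (f ` ({..<n} \<times> {..<n}))"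
      using that by (intro Max_ge) auto
    ultimately show ?thesis using nbhd_mono_radius by blast
  qed
  then show ?thesis by blast
qed

lemma sphere_subset_nbhd: "sphere E S r \<subseteq> nbhd E S r"
  by (cases r) auto

lemma sphere_eq: "r \<ge> 1 \<Longrightarrow> sphere E S r = nbhd E S r - nbhd E S (r - 1)"
  by (cases r) auto

text \<open>This is the clock of the pursuit: a robber who is on the sphere of radius
  \<open>r\<close> after \<open>j\<close> rounds shows that \<open>j\<close> is at least
  \<open>r\<close>, so the cops have had at least \<open>r\<close> moves.\<close>

lemma sphere_radius_le:
  assumes "u \<in> sphere E S r" "u \<in> nbhd E S j"
  shows "r \<le> j"
proof (rule ccontr)
  assume "\<not> r \<le> j"
  then have "r \<ge> 1" "j \<le> r - 1" by auto
  then show False using assms nbhd_mono_radius[of j "r - 1"] by (auto simp: sphere_eq)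
qed

text \<open>\<open>t\<close> is the number of moves within which the team can occupy all of
  \<open>S\<close>. The injection goes into list positions and not into vertices because several
  cops may share a vertex.\<close>

definition guards :: "(nat \<Rightarrow> nat \<Rightarrow> bool) \<Rightarrow> nat list \<Rightarrow> nat set \<Rightarrow> nat \<Rightarrow> bool" where
  "guards E cs S t \<longleftrightarrow>
     (\<exists>g. inj_on g S \<and> (\<forall>w\<in>S. g w < length cs \<and> w \<in> nbhd E {cs ! g w} t))"

abbreviation steps_to :: "(nat \<Rightarrow> nat \<Rightarrow> bool) \<Rightarrow> nat list \<Rightarrow> nat list \<Rightarrow> bool" where
  "steps_to E \<equiv> list_all2 (\<lambda>c c'. c' = c \<or> E c c')"

lemma steps_to_preimage:
  "steps_to E cs cs' \<Longrightarrow> c' \<in> set cs' \<Longrightarrow> \<exists>c\<in>set cs. c' = c \<or> E c c'"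
  by (induction rule: list_all2_induct) auto

lemma steps_to_refl: "steps_to E cs cs"
  by (simp add: list_all2_same)

lemma guards_mono_radius: "guards E cs S s \<Longrightarrow> s \<le> t \<Longrightarrow> guards E cs S t"
  unfolding guards_def using nbhd_mono_radius by blast

lemma guards_empty: "guards E cs {} t"
  by (simp add: guards_def)

lemma guards_subset: "guards E cs S t \<Longrightarrow> S' \<subseteq> S \<Longrightarrow> guards E cs S' t"
  unfolding guards_def by (meson inj_on_subset subsetD)

lemma guards_append: 
  assumes "guards E cs S t"
  shows "guards E (ds @ cs) S t"
proof -
  obtain g where g: "inj_on g S" "\<forall>w\<in>S. g w < length cs \<and> w \<in> nbhd E {cs ! g w} t"
    using assms guards_def by auto
  have "inj_on (\<lambda>w. length ds + g w) S" using g(1) by (auto simp: inj_on_def)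
  moreover have "\<forall>w\<in>S. length ds + g w < length (ds @ cs) \<and> w \<in> nbhd E {(ds @ cs) ! (length ds + g w)} t"
    using g(2) by auto
  ultimately show ?thesis unfolding guards_def by (intro exI conjI)
qed

lemma guards_caught: "guards E cs S 0 \<Longrightarrow> u \<in> S \<Longrightarrow> u \<in> set cs"
  by (metis guards_def nbhd.simps(1) nth_mem singletonD)

text \<open>Every assigned cop takes the first step of a path to its target and the others stay.
  Truncated subtraction lets a team that has arrived stay where it is.\<close>

lemma guards_step:
  assumes "guards E cs S t"
  shows "\<exists>cs'. steps_to E cs cs' \<and> guards E cs' S (t - 1)"
proof (cases t)
  case 0
  then show ?thesis using assms steps_to_refl by auto
next
  case (Suc s)
  obtain g where g: "inj_on g S" "\<forall>w\<in>S. g w < length cs \<and> w \<in> nbhd E {cs ! g w} t"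
    using assms guards_def by auto
  define nx where "nx i = (if i \<in> g ` S then
      SOME c'. (c' = cs ! i \<or> E (cs ! i) c') \<and> inv_into S g i \<in> nbhd E {c'} s else cs ! i)" for i
  define cs' where "cs' = map nx [0..<length cs]"
  have nx: "(nx (g w) = cs ! g w \<or> E (cs ! g w) (nx (g w))) \<and> w \<in> nbhd E {nx (g w)} s" if "w \<in> S" for w
  proof -
    have inv: "inv_into S g (g w) = w" using that g(1) by simp
    have "\<exists>c'. (c' = cs ! g w \<or> E (cs ! g w) c') \<and> w \<in> nbhd E {c'} s"
      using g(2) that Suc nbhd_SucE by metis
    from someI_ex[OF this] show ?thesis
      using that by (simp add: nx_def inv)
  qed
  have "steps_to E cs cs'"
    unfolding list_all2_conv_all_nth
  proof (intro conjI allI impI)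
    show "length cs = length cs'" by (simp add: cs'_def)
    fix i assume i: "i < length cs"
    show "cs' ! i = cs ! i \<or> E (cs ! i) (cs' ! i)"
    proof (cases "i \<in> g ` S")
      case True
      then show ?thesis using nx i by (auto simp: cs'_def)
    qed (use i in \<open>auto simp: cs'_def nx_def\<close>)
  qed
  moreover have "guards E cs' S s"
    unfolding guards_def using g nx by (intro exI[of _ g]) (auto simp: cs'_def)
  ultimately show ?thesis using Suc by auto
qed

lemma cw_cops_one_step:
  assumes "steps_to E cs cs'" "u \<in> set cs'"
  shows "cw_cops E cs u"
  using assms cops_move robber_caught by blast

text \<open>It is the cops' turn, so a remaining distance of one is as good as zero.\<close>

lemma guards_capture:
  assumes "guards E gs S t" "t \<le> 1" "u \<in> S"
  shows "cw_cops E (xs @ gs @ ys) u"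
proof -
  obtain gs' where gs': "steps_to E gs gs'" "guards E gs' S 0"
    using guards_step[OF guards_mono_radius[OF assms(1,2)]] by auto
  have "steps_to E (xs @ gs @ ys) (xs @ gs' @ ys)"
    using gs' by (intro list_all2_appendI steps_to_refl)
  moreover have "u \<in> set gs'" using guards_caught gs' assms by blast
  ultimately show ?thesis using cw_cops_one_step by fastforce
qed

text \<open>The robber may dawdle inside \<open>B\<close>; the team \<open>cl\<close>, which sets out to occupy all of
  \<open>B\<close>, forces it to leave within \<open>L\<close> rounds.\<close>
lemma dawdling_robber:
  assumes graph: "graph_on n E"
    and exit: "\<And>j' cl' gs' zs' u'.
       (steps_to E)\<^sup>*\<^sup>* cl cl' \<Longrightarrow> u' \<notin> B \<Longrightarrow> \<exists>u\<in>B. E u u' \<Longrightarrow> u' \<in> nbhd E {p} j' \<Longrightarrow>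
       guards E gs' S0 (T0 - j') \<Longrightarrow> guards E zs' S1 (T1 - j') \<Longrightarrow>
       cw_cops E (xs @ cl' @ gs' @ zs' @ rest) u'"
    and "guards E cl B L" "guards E gs S0 (T0 - j)" "guards E zs S1 (T1 - j)"
    and "u \<in> B" "u \<in> nbhd E {p} j"
  shows "cw_cops E (xs @ cl @ gs @ zs @ rest) u"
  using assms(2-)
proof (induction L arbitrary: j cl gs zs u rule: nat.induct)
  case zero
  have "u \<in> set cl" using guards_caught[OF zero(2,5)] .
  then show ?case by (intro cops_caught) auto
next
  case (Suc L)
  obtain cl' where cl': "steps_to E cl cl'" "guards E cl' B L"
    using guards_step[OF Suc.prems(2)] by auto
  obtain gs' where gs': "steps_to E gs gs'" "guards E gs' S0 (T0 - Suc j)"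
    using guards_step[OF Suc.prems(3)] by auto
  obtain zs' where zs': "steps_to E zs zs'" "guards E zs' S1 (T1 - Suc j)"
    using guards_step[OF Suc.prems(4)] by auto
  have "cw_robber E (xs @ cl' @ gs' @ zs' @ rest) u"
  proof (rule robber_move)
    fix u' assume u': "u' = u \<or> E u u'"
    have near: "u' \<in> nbhd E {p} (Suc j)" using u' Suc.prems(6) by auto
    show "cw_cops E (xs @ cl' @ gs' @ zs' @ rest) u'"
    proof (cases "u' \<in> B")
      case True
      show ?thesis
      proof (rule Suc.IH[OF _ cl'(2) gs'(2) zs'(2) True near])
        fix j' cl'' gs'' zs'' u''
        assume *: "(steps_to E)\<^sup>*\<^sup>* cl' cl''" "u'' \<notin> B" "\<exists>u\<in>B. E u u''" "u'' \<in> nbhd E {p} j'"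
          "guards E gs'' S0 (T0 - j')" "guards E zs'' S1 (T1 - j')"
        \<comment> \<open>The exit hypothesis speaks of positions reachable from \<open>cl\<close>,
          so the move from \<open>cl\<close> to \<open>cl'\<close> is prepended.\<close>
        show "cw_cops E (xs @ cl'' @ gs'' @ zs'' @ rest) u''"
          using Suc.prems(1)[OF converse_rtranclp_into_rtranclp[of "steps_to E", OF cl'(1) *(1)] *(2-)] .
      qed
    next
      case False
      then have "\<exists>u\<in>B. E u u'" using u' Suc.prems(5) by auto
      then show ?thesis
        using Suc.prems(1)[OF r_into_rtranclp[of "steps_to E", OF cl'(1)] False _ near gs'(2) zs'(2)] by blast
    qed
  qed
  moreover have "steps_to E (xs @ cl @ gs @ zs @ rest) (xs @ cl' @ gs' @ zs' @ rest)"
    using cl' gs' zs' by (intro list_all2_appendI steps_to_refl)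
  ultimately show ?case using cops_move by blast
qed

definition reaches :: "(nat \<Rightarrow> nat \<Rightarrow> bool) \<Rightarrow> nat list \<Rightarrow> nat set \<Rightarrow> bool" where
  "reaches E cs S \<longleftrightarrow> (\<forall>c\<in>set cs. \<forall>u\<in>S. E\<^sup>*\<^sup>* c u)"

lemma reaches_step:
  assumes "graph_on n E" "reaches E cs S" "steps_to E cs cs'"
  shows "reaches E cs' S"
  unfolding reaches_def
proof (intro ballI)
  fix c' u assume c': "c' \<in> set cs'" and u: "u \<in> S"
  then obtain c where "c \<in> set cs" "c' = c \<or> E c c'"
    using steps_to_preimage[OF assms(3)] by blast
  then have "c' = c \<or> E c' c" "E\<^sup>*\<^sup>* c u" using assms(1,2) u by (auto simp: graph_on_def reaches_def)
  then show "E\<^sup>*\<^sup>* c' u" by (auto intro: converse_rtranclp_into_rtranclp)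
qed

lemma reaches_steps:
  assumes "(steps_to E)\<^sup>*\<^sup>* cs cs'" "graph_on n E" "reaches E cs S"
  shows "reaches E cs' S \<and> length cs' = length cs"
  using assms
proof (induction rule: rtranclp_induct)
  case (step ds es)
  then show ?case using reaches_step[OF step(4) _ step(2)] list_all2_lengthD[OF step(2)] by simp
qed simp

text \<open>The cleaning team has no deadline, so any injection of \<open>B\<close> into its
  positions will do: in a finite graph a single radius bounds all finite distances.\<close>

lemma reaches_guards:
  assumes "reaches E cs S" "set cs \<subseteq> {..<n}" "B \<subseteq> S" "S \<subseteq> {..<n}" "card B \<le> length cs"
  shows "\<exists>L. guards E cs B L"
proof -
  obtain L where L: "\<forall>u<n. \<forall>w<n. E\<^sup>*\<^sup>* u w \<longrightarrow> w \<in> nbhd E {u} L"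
    using uniform_nbhd_radius[of n E] by (elim exE)
  have "finite B" using finite_subset[OF order_trans[OF assms(3,4)]] by simp
  then obtain g where g: "inj_on g B" "g ` B \<subseteq> {..<length cs}"
    using card_le_inj[of B "{..<length cs}"] assms(5) by (auto simp del: nbhd.simps)
  have "guards E cs B L"
    unfolding guards_def
  proof (intro exI[of _ g] conjI ballI g(1))
    fix w assume w: "w \<in> B"
    show *: "g w < length cs" using g w by auto
    then have "cs ! g w \<in> set cs" by simp
    then show "w \<in> nbhd E {cs ! g w} L" 
      using L assms(1-4) w unfolding reaches_def by (meson lessThan_iff subsetD)
  qed
  then show ?thesis by blast
qed

lemma steps_to_subset:
  assumes "graph_on n E" "(steps_to E)\<^sup>*\<^sup>* cs cs'" "set cs \<subseteq> {..<n}"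
  shows "set cs' \<subseteq> {..<n}"
  using assms(2,3)
proof induction
  case (step ds es)
  show ?case
  proof
    fix c' assume "c' \<in> set es"
    then obtain c where "c \<in> set ds" "c' = c \<or> E c c'"
      using steps_to_preimage[OF step(2)] by blast
    then show "c' \<in> {..<n}" using step assms(1) by (auto simp: graph_on_def)
  qed
qed

text \<open>One stage of the pursuit. The cleaning team drives the robber out of the ball of radius
  \<open>r - 1\<close>; he then enters \<open>X\<close>, where he is caught, or the sphere of radius
  \<open>r\<close>, after at least \<open>r\<close> rounds. By then \<open>gs\<close> needs at most
  one more move and has the turn, so he is caught unless he stands on \<open>A\<close>; in that case
  \<open>zs\<close> needs at most \<open>t\<close> further moves, which is what the next stage
  starts from.\<close>

lemma robber_in_ball:
  assumes graph: "graph_on n E"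
    and xs: "set xs = X"
    and p: "p \<in> {..<n} - X" and r: "r \<ge> 1"
    and cl: "reaches E cl ({..<n} - X)" "set cl \<subseteq> {..<n}" "card (nbhd E {p} (r - 1)) \<le> length cl"
    and gs: "guards E gs (sphere E {p} r - A - X) (Suc r)"
    and zs: "guards E zs S (r + t)"
    and continue: "\<And>a cl' gs' zs'. a \<in> A - X \<Longrightarrow> a < n \<Longrightarrow> reaches E cl' ({..<n} - X) \<Longrightarrow> set cl' \<subseteq> {..<n} \<Longrightarrow>
       length cl' = length cl \<Longrightarrow> guards E zs' S t \<Longrightarrow>
       cw_cops E (xs @ cl' @ gs' @ zs' @ rest) a"
  shows "cw_cops E (xs @ cl @ gs @ zs @ rest) p"
proof -
  define B where "B = nbhd E {p} (r - 1) - X"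
  have fin: "nbhd E {p} (r - 1) \<subseteq> {..<n}" using nbhd_subset[OF graph] p by simp
  have "card B \<le> card (nbhd E {p} (r - 1))"
    unfolding B_def using fin finite_subset by (intro card_mono) auto
  then have cardB: "card B \<le> length cl" using cl(3) by simp
  have BX: "B \<subseteq> {..<n} - X" using fin by (auto simp: B_def)
  obtain L where L: "guards E cl B L"
    using reaches_guards[OF cl(1,2) BX _ cardB] by blast
  show ?thesis
  proof (rule dawdling_robber[OF graph _ L, where p = p and j = 0 and ?T0.0 = "Suc r" and ?T1.0 = "r + t"])
    show "guards E gs (sphere E {p} r - A - X) (Suc r - 0)" "guards E zs S (r + t - 0)"
      using gs zs by auto
    show "p \<in> B" using p nbhd_mono_radius[of 0 "r - 1" E "{p}"] by (auto simp: B_def)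
    show "p \<in> nbhd E {p} 0" by simp
    fix j' cl' gs' zs' u'
    assume cl': "(steps_to E)\<^sup>*\<^sup>* cl cl'" and u': "u' \<notin> B" "\<exists>u\<in>B. E u u'" "u' \<in> nbhd E {p} j'"
      and gs': "guards E gs' (sphere E {p} r - A - X) (Suc r - j')"
      and zs': "guards E zs' S (r + t - j')"
    show "cw_cops E (xs @ cl' @ gs' @ zs' @ rest) u'"
    proof (cases "u' \<in> X")
      case True
      then show ?thesis using xs by (intro cops_caught) auto
    next
      case False
      have "u' \<in> nbhd E {p} (Suc (r - 1))" using u'(2) by (auto simp: B_def)
      then have sph: "u' \<in> sphere E {p} r"
        using u'(1) False r by (auto simp: B_def sphere_eq)
      have j': "r \<le> j'" by (rule sphere_radius_le[OF sph u'(3)])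
      show ?thesis
      proof (cases "u' \<in> A")
        case True
        have "u' < n" using u'(2) graph by (auto simp: graph_on_def)
        then show ?thesis
          using True False reaches_steps[OF cl' graph cl(1)] steps_to_subset[OF graph cl' cl(2)]
            guards_mono_radius[OF zs', of t] j'
          by (intro continue) auto
      next
        case notA: False
        then show ?thesis
          using guards_capture[OF gs', where u = u' and xs = "xs @ cl'" and ys = "zs' @ rest"] sph False j' by auto
      qed
    qed
  qed
qed

section \<open>Random placements and Hall's theorem\<close>

text \<open>Union bound by counting: of the \<open>n ^ M\<close> lists of length \<open>M\<close>,
  exactly \<open>card (C i) ^ M\<close> stay inside \<open>C i\<close>.\<close>

lemma exists_list_escaping_sets:
  fixes C :: "'i \<Rightarrow> nat set"
  assumes n: "n > 0" and fin: "finite I" and sub: "\<And>i. i \<in> I \<Longrightarrow> C i \<subseteq> {..<n}"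
    and small: "(\<Sum>i\<in>I. (real (card (C i)) / real n) ^ M) < 1"
  shows "\<exists>zs. length zs = M \<and> set zs \<subseteq> {..<n} \<and> (\<forall>i\<in>I. \<not> set zs \<subseteq> C i)"
proof (rule ccontr)
  assume neg: "\<not> ?thesis"
  define lists_in where "lists_in S = {zs. set zs \<subseteq> S \<and> length zs = M}" for S :: "nat set"
  have card_lists: "card (lists_in S) = card S ^ M" "finite (lists_in S)" if "finite S" for S
    using that card_lists_length_eq[of S M] finite_lists_length_eq[of S M] by (auto simp: lists_in_def)
  have finC: "finite (C i)" if "i \<in> I" for i using sub[OF that] finite_subset by blast
  have "lists_in {..<n} \<subseteq> (\<Union>i\<in>I. lists_in (C i))"
    using neg by (auto simp: lists_in_def)
  then have "card (lists_in {..<n}) \<le> card (\<Union>i\<in>I. lists_in (C i))"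
    using fin finC card_lists by (intro card_mono) auto
  also have "\<dots> \<le> (\<Sum>i\<in>I. card (lists_in (C i)))" by (rule card_UN_le[OF fin])
  also have "\<dots> = (\<Sum>i\<in>I. card (C i) ^ M)" using finC card_lists by (intro sum.cong) auto
  finally have "n ^ M \<le> (\<Sum>i\<in>I. card (C i) ^ M)" using card_lists[of "{..<n}"] by simp
  then have "real (n ^ M) \<le> real (\<Sum>i\<in>I. card (C i) ^ M)" by (simp only: of_nat_le_iff)
  then have "1 \<le> (\<Sum>i\<in>I. real (card (C i)) ^ M) / real n ^ M" using n by (simp add: field_simps)
  also have "\<dots> = (\<Sum>i\<in>I. (real (card (C i)) / real n) ^ M)"
    by (simp add: sum_divide_distrib power_divide)
  finally show False using small by simp
qed

lemma power_div_le_exp: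
  fixes c x n :: real
  assumes "c \<le> n - x" "n > 0" "c \<ge> 0"
  shows "(c / n) ^ M \<le> exp (- (x * real M / n))"
proof -
  have "c / n \<le> 1 - x / n" using assms by (simp add: field_simps)
  also have "\<dots> \<le> exp (- (x / n))" using exp_ge_add_one_self[of "- (x / n)"] by simp
  finally have "(c / n) ^ M \<le> exp (- (x / n)) ^ M" using assms by (intro power_mono) auto
  also have "\<dots> = exp (- (x * real M / n))" by (simp add: exp_of_nat_mult[symmetric] field_simps)
  finally show ?thesis .
qed

text \<open>A single term of the exponential series gives \<open>b ^ b / fact b \<le> exp b\<close>,
  and \<open>fact b\<close> times the binomial coefficient is at most \<open>m ^ b\<close>.\<close>

lemma binomial_le_exp_power:
  assumes "b > 0"
  shows "real (m choose b) \<le> (exp 1 * real m / real b) ^ b"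
proof (cases "b \<le> m")
  case True
  have "real b ^ b / fact b \<le> exp (real b)"
  proof -
    have s: "summable (\<lambda>k. real b ^ k / fact k)" using summable_exp[of "real b"] by (simp add: field_simps)
    have "(\<Sum>k\<in>{b}. real b ^ k / fact k) \<le> (\<Sum>k. real b ^ k / fact k)"
      by (rule sum_le_suminf[OF s]) auto
    then show ?thesis by (simp add: exp_def field_simps)
  qed
  then have f: "real b ^ b \<le> exp 1 ^ b * fact b"
    by (simp add: field_simps exp_of_nat_mult[symmetric])
  have "real (fact b * (m choose b)) \<le> real (m ^ b)"
  proof -
    have "fact b * (m choose b) = fact m div fact (m - b)"
      using binomial_fact_lemma[OF True] by (metis div_mult_self_is_m fact_gt_zero mult.commute mult.assoc)
    also have "\<dots> \<le> m ^ b" by (rule fact_div_fact_le_pow[OF True])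
    finally show ?thesis using of_nat_le_iff by blast
  qed
  then have "real (m choose b) * fact b \<le> real m ^ b" by (simp add: mult.commute)
  then have "real (m choose b) * real b ^ b \<le> real (m choose b) * (exp 1 ^ b * fact b)"
    using f by (intro mult_left_mono) auto
  also have "\<dots> \<le> exp 1 ^ b * real m ^ b"
    using \<open>real (m choose b) * fact b \<le> real m ^ b\<close> mult_left_mono[of _ _ "exp 1 ^ b"] by (simp add: mult_ac)
  finally show ?thesis using assms by (simp add: field_simps power_mult_distrib)
qed (auto simp: binomial_eq_0)

text \<open>If \<open>b i\<close> of the sets \<open>W i w\<close> are missed, the list lies in the
  complement of their union, which has at least \<open>b i * \<omega> i\<close> elements by
  disjointness. The union bound runs over all \<open>i\<close> and all \<open>b i\<close>-element
  subsets of \<open>T i\<close>.\<close>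

lemma exists_list_hitting_most:
  fixes T :: "'i \<Rightarrow> nat set" and W :: "'i \<Rightarrow> nat \<Rightarrow> nat set" and m \<omega> :: "'i \<Rightarrow> real" and b :: "'i \<Rightarrow> nat"
  assumes n: "n > 0" and fin: "finite I"
    and T: "\<And>i. i \<in> I \<Longrightarrow> finite (T i)" "\<And>i. i \<in> I \<Longrightarrow> real (card (T i)) \<le> m i"
    and W: "\<And>i w. i \<in> I \<Longrightarrow> w \<in> T i \<Longrightarrow> W i w \<subseteq> {..<n}"
           "\<And>i w. i \<in> I \<Longrightarrow> w \<in> T i \<Longrightarrow> \<omega> i \<le> real (card (W i w))"
           "\<And>i w w'. i \<in> I \<Longrightarrow> w \<in> T i \<Longrightarrow> w' \<in> T i \<Longrightarrow> w \<noteq> w' \<Longrightarrow> W i w \<inter> W i w' = {}"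
    and b: "\<And>i. i \<in> I \<Longrightarrow> b i > 0"
    and small: "\<And>i. i \<in> I \<Longrightarrow>
      real (card I) * (exp 1 * m i / real (b i) * exp (- (\<omega> i * real M / real n))) ^ b i < 1"
  shows "\<exists>zs. length zs = M \<and> set zs \<subseteq> {..<n} \<and>
           (\<forall>i\<in>I. card {w\<in>T i. W i w \<inter> set zs = {}} < b i)"
proof (cases "I = {}")
  case True
  then show ?thesis using n by (intro exI[of _ "replicate M 0"]) auto
next
  case False
  define J where "J = (SIGMA i:I. {B. B \<subseteq> T i \<and> card B = b i})"
  define C where "C = (\<lambda>(i, B). {..<n} - (\<Union>w\<in>B. W i w))"
  have finJ: "finite J" using fin T(1) by (auto simp: J_def)
  have bound: "(real (card (C (i, B))) / real n) ^ M \<le> exp (- (\<omega> i * real M / real n)) ^ b i"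
    if i: "i \<in> I" and B: "B \<subseteq> T i" "card B = b i" for i B
  proof -
    have finB: "finite B" using B(1) T(1)[OF i] finite_subset by blast
    have "real (b i) * \<omega> i = (\<Sum>w\<in>B. \<omega> i)" using B by simp
    also have "\<dots> \<le> (\<Sum>w\<in>B. real (card (W i w)))" using W(2)[OF i] B by (intro sum_mono) auto
    also have "\<dots> = real (\<Sum>w\<in>B. card (W i w))" by simp
    also have "(\<Sum>w\<in>B. card (W i w)) = card (\<Union>w\<in>B. W i w)"
    proof (rule card_UN_disjoint[symmetric, OF finB])
      show "\<forall>w\<in>B. finite (W i w)"
        using W(1)[OF i] B(1) by (auto intro: finite_subset[OF _ finite_lessThan])
      show "\<forall>w\<in>B. \<forall>w'\<in>B. w \<noteq> w' \<longrightarrow> W i w \<inter> W i w' = {}"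
        using W(3)[OF i] B(1) by blast
    qed
    finally have "real (b i) * \<omega> i \<le> real (card (\<Union>w\<in>B. W i w))" .
    moreover have "(\<Union>w\<in>B. W i w) \<subseteq> {..<n}" using W(1)[OF i] B by auto
    moreover from this have "card (C (i, B)) = n - card (\<Union>w\<in>B. W i w)" "card (\<Union>w\<in>B. W i w) \<le> n"
      using card_mono[of "{..<n}"] by (auto simp: C_def card_Diff_subset finite_subset)
    ultimately have "real (card (C (i, B))) \<le> real n - real (b i) * \<omega> i" by simp
    then have "(real (card (C (i, B))) / real n) ^ M \<le> exp (- (real (b i) * \<omega> i * real M / real n))"
      using n by (intro power_div_le_exp) auto
    then show ?thesis by (simp add: exp_of_nat_mult[symmetric] mult_ac)
  qed
  have "(\<Sum>j\<in>J. (real (card (C j)) / real n) ^ M)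
      = (\<Sum>i\<in>I. \<Sum>B\<in>{B. B \<subseteq> T i \<and> card B = b i}. (real (card (C (i, B))) / real n) ^ M)"
    unfolding J_def using fin T(1) by (subst sum.Sigma) auto
  also have "\<dots> < (\<Sum>i\<in>I. 1 / real (card I))"
  proof (rule sum_strict_mono[OF fin False])
    fix i assume i: "i \<in> I"
    have "(\<Sum>B\<in>{B. B \<subseteq> T i \<and> card B = b i}. (real (card (C (i, B))) / real n) ^ M)
        \<le> (\<Sum>B\<in>{B. B \<subseteq> T i \<and> card B = b i}. exp (- (\<omega> i * real M / real n)) ^ b i)"
      using bound[OF i] by (intro sum_mono) auto
    also have "\<dots> = real (card (T i) choose b i) * exp (- (\<omega> i * real M / real n)) ^ b i"
      using n_subsets[OF T(1)[OF i]] by simp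
    also have "\<dots> \<le> (exp 1 * m i / real (b i)) ^ b i * exp (- (\<omega> i * real M / real n)) ^ b i"
    proof (rule mult_right_mono)
      have "real (card (T i) choose b i) \<le> (exp 1 * real (card (T i)) / real (b i)) ^ b i"
        by (rule binomial_le_exp_power[OF b[OF i]])
      also have "\<dots> \<le> (exp 1 * m i / real (b i)) ^ b i"
        using T(2)[OF i] by (intro power_mono divide_right_mono mult_left_mono) auto
      finally show "real (card (T i) choose b i) \<le> (exp 1 * m i / real (b i)) ^ b i" .
    qed auto
    also have "\<dots> = (exp 1 * m i / real (b i) * exp (- (\<omega> i * real M / real n))) ^ b i"
      by (rule power_mult_distrib[symmetric])
    also have "\<dots> < 1 / real (card I)"
      using small[OF i] fin False by (simp add: field_simps card_gt_0_iff)
    finally show "(\<Sum>B\<in>{B. B \<subseteq> T i \<and> card B = b i}. (real (card (C (i, B))) / real n) ^ M) < 1 / real (card I)" .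
  qed
  also have "\<dots> = 1" using fin False by simp
  finally have *: "(\<Sum>j\<in>J. (real (card (C j)) / real n) ^ M) < 1" .
  obtain zs where zs: "length zs = M" "set zs \<subseteq> {..<n}" "\<forall>j\<in>J. \<not> set zs \<subseteq> C j"
    using exists_list_escaping_sets[OF n finJ _ *] by (auto simp: C_def)
  have "card {w\<in>T i. W i w \<inter> set zs = {}} < b i" if i: "i \<in> I" for i
  proof (rule ccontr)
    assume "\<not> ?thesis"
    then obtain B where B: "B \<subseteq> {w\<in>T i. W i w \<inter> set zs = {}}" "card B = b i"
      by (meson obtain_subset_with_card_n not_less)
    then have "(i, B) \<in> J" using i by (auto simp: J_def)
    moreover have "set zs \<subseteq> C (i, B)" using B zs(2) by (auto simp: C_def)
    ultimately show False using zs(3) by blast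
  qed
  then show ?thesis using zs by blast
qed

text \<open>Provides Hall's condition for all sets of a family at once. For a set \<open>V\<close>
  of size \<open>j\<close> the failure probability is at most \<open>(n * q) ^ j\<close>, where
  \<open>n ^ j\<close> counts the sets \<open>Y\<close>; this is small enough to be summed over all
  \<open>V\<close>.\<close>

lemma exists_list_expanding:
  fixes F :: "nat set set" and N :: "nat set \<Rightarrow> nat set" and \<theta> :: real
  assumes n: "n > 0" and F: "\<And>V. V \<in> F \<Longrightarrow> V \<subseteq> {..<n}" "{} \<notin> F"
    and N: "\<And>V. V \<in> F \<Longrightarrow> N V \<subseteq> {..<n}" "\<And>V. V \<in> F \<Longrightarrow> \<theta> * real (card V) \<le> real (card (N V))"
    and small: "2 * real n ^ 3 * exp (- ((\<theta> - 1) * real M / real n)) \<le> 1"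
  shows "\<exists>zs. length zs = M \<and> set zs \<subseteq> {..<n} \<and> (\<forall>V\<in>F. card V \<le> card (set zs \<inter> N V))"
proof -
  define J where "J = (SIGMA V:F. {Y. Y \<subseteq> {..<n} \<and> card Y = card V})"
  \<comment> \<open>If \<open>zs\<close> meets \<open>N V\<close> in fewer than \<open>card V\<close> points, some \<open>Y\<close> with \<open>card Y = card V\<close> covers these points.\<close>
  define C where "C = (\<lambda>(V, Y). ({..<n} - N V) \<union> Y)"
  define q where "q = exp (- ((\<theta> - 1) * real M / real n))"
  have finF: "finite F" using F(1) by (intro finite_subset[of F "Pow {..<n}"]) auto
  have finJ: "finite J" using finF by (auto simp: J_def)
  have bound: "(real (card (C (V, Y))) / real n) ^ M \<le> q ^ card V"
    if V: "V \<in> F" and Y: "Y \<subseteq> {..<n}" "card Y = card V" for V Y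
  proof -
    have "card (C (V, Y)) \<le> card ({..<n} - N V) + card Y" by (simp add: C_def card_Un_le)
    moreover have "card ({..<n} - N V) = n - card (N V)" "card (N V) \<le> n"
      using N(1)[OF V] card_mono[of "{..<n}" "N V"] by (auto simp: card_Diff_subset finite_subset)
    ultimately have "real (card (C (V, Y))) \<le> real n - real (card (N V)) + real (card V)"
      using Y by linarith
    also have "\<dots> \<le> real n - real (card V) * (\<theta> - 1)" using N(2)[OF V] by (simp add: algebra_simps)
    finally have "(real (card (C (V, Y))) / real n) ^ M \<le> exp (- (real (card V) * (\<theta> - 1) * real M / real n))"
      using n by (intro power_div_le_exp) auto
    then show ?thesis by (simp add: q_def exp_of_nat_mult[symmetric] mult_ac)
  qed
  have nq: "real n * q \<le> 1 / (2 * real n ^ 2)" using small n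
    by (simp add: q_def field_simps power2_eq_square power3_eq_cube)
  have "(\<Sum>j\<in>J. (real (card (C j)) / real n) ^ M)
      = (\<Sum>V\<in>F. \<Sum>Y\<in>{Y. Y \<subseteq> {..<n} \<and> card Y = card V}. (real (card (C (V, Y))) / real n) ^ M)"
    unfolding J_def using finF by (subst sum.Sigma) auto
  also have "\<dots> \<le> (\<Sum>V\<in>F. (real n * q) ^ card V)"
  proof (rule sum_mono)
    fix V assume V: "V \<in> F"
    have "(\<Sum>Y\<in>{Y. Y \<subseteq> {..<n} \<and> card Y = card V}. (real (card (C (V, Y))) / real n) ^ M)
        \<le> (\<Sum>Y\<in>{Y. Y \<subseteq> {..<n} \<and> card Y = card V}. q ^ card V)"
      using bound[OF V] by (intro sum_mono) auto
    also have "\<dots> = real (n choose card V) * q ^ card V" using n_subsets[of "{..<n}" "card V"] by simp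
    also have "\<dots> \<le> real n ^ card V * q ^ card V"
    proof (rule mult_right_mono)
      have "card V \<le> n" using F(1)[OF V] card_mono[of "{..<n}" V] by simp
      then show "real (n choose card V) \<le> real n ^ card V"
        using binomial_le_pow of_nat_le_iff by (metis of_nat_power)
    qed (simp add: q_def)
    finally show "(\<Sum>Y\<in>{Y. Y \<subseteq> {..<n} \<and> card Y = card V}. (real (card (C (V, Y))) / real n) ^ M)
        \<le> (real n * q) ^ card V" by (simp add: power_mult_distrib)
  qed
  \<comment> \<open>Over all nonempty sets the sum is a binomial expansion,
    \<open>(1 + n * q) ^ n - 1\<close>. Since \<open>n * q\<close> is at most
    \<open>1 / (2 * n ^ 2)\<close>, it is at most \<open>exp (1 / 2) - 1\<close>.\<close>
  also have "\<dots> \<le> (\<Sum>V\<in>Pow {..<n} - {{}}. (real n * q) ^ card V)"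
    using F by (intro sum_mono2) (auto simp: q_def)
  also have "\<dots> = (\<Sum>V\<in>Pow {..<n}. (real n * q) ^ card V) - 1"
    by (subst sum_diff1) auto
  also have "(\<Sum>V\<in>Pow {..<n}. (real n * q) ^ card V) = (1 + real n * q) ^ n"
    using prod_add[of "{..<n}" "\<lambda>_. real n * q" "\<lambda>_. 1"] by (simp add: add.commute)
  also have "\<dots> \<le> exp (real n * q) ^ n"
    using exp_ge_add_one_self[of "real n * q"] by (intro power_mono) (auto simp: q_def)
  also have "\<dots> = exp (real n * (real n * q))" by (simp add: exp_of_nat_mult)
  also have "\<dots> \<le> exp (1 / 2)"
  proof -
    have "real n * (real n * q) \<le> real n * (1 / (2 * real n ^ 2))" using nq n by (intro mult_left_mono) auto
    also have "\<dots> \<le> 1 / 2" using n by (simp add: power2_eq_square field_simps)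
    finally show ?thesis by simp
  qed
  also have "exp (1 / 2) - 1 < (1 :: real)"
  proof -
    have "exp (1 / 2) ^ 2 = (exp 1 :: real)" by (simp add: exp_of_nat_mult[symmetric])
    then have "exp (1 / 2) ^ 2 < (2 :: real) ^ 2" using exp_le by simp
    then have "exp (1 / 2) < (2 :: real)" using power_less_imp_less_base[of _ 2 "2::real"] by simp
    then show ?thesis by simp
  qed
  finally have *: "(\<Sum>j\<in>J. (real (card (C j)) / real n) ^ M) < 1" by simp
  have "\<And>j. j \<in> J \<Longrightarrow> C j \<subseteq> {..<n}" by (auto simp: C_def J_def)
  from exists_list_escaping_sets[OF n finJ this *]
  obtain zs where zs: "length zs = M" "set zs \<subseteq> {..<n}" "\<forall>j\<in>J. \<not> set zs \<subseteq> C j" by auto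
  have "card V \<le> card (set zs \<inter> N V)" if V: "V \<in> F" for V
  proof (rule ccontr)
    assume "\<not> ?thesis"
    moreover have "card V \<le> n" using F(1)[OF V] card_mono[of "{..<n}" V] by simp
    moreover have "set zs \<inter> N V \<subseteq> {..<n}" using zs by auto
    ultimately obtain Y where "set zs \<inter> N V \<subseteq> Y" "Y \<subseteq> {..<n}" "card Y = card V"
      using exists_subset_between[of "set zs \<inter> N V" "card V" "{..<n}"] by auto
    moreover from this have "set zs \<subseteq> C (V, Y)" using zs(2) by (auto simp: C_def)
    ultimately show False using zs(3) V by (auto simp: J_def)
  qed
  then show ?thesis using zs by blast
qed

text \<open>The Halmos-Vaughan induction: a nonempty proper subset for which Hall's condition is
  tight is matched first, and its neighbours are then withheld from the rest; if there is none, an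
  arbitrary pair may be matched and removed.\<close>

lemma hall_marriage:
  fixes S :: "'a set" and R :: "'a \<Rightarrow> 'b set"
  assumes "finite S" and "\<And>x. x \<in> S \<Longrightarrow> finite (R x)"
    and "\<And>T. T \<subseteq> S \<Longrightarrow> card T \<le> card (\<Union>x\<in>T. R x)"
  shows "\<exists>f. inj_on f S \<and> (\<forall>x\<in>S. f x \<in> R x)"
  using assms
proof (induction "card S" arbitrary: S R rule: less_induct)
  case less
  show ?case
  proof (cases "\<exists>T. T \<subset> S \<and> T \<noteq> {} \<and> card T = card (\<Union>x\<in>T. R x)")
    case True
    then obtain T where T: "T \<subset> S" "T \<noteq> {}" "card T = card (\<Union>x\<in>T. R x)" by blast
    have finT: "finite T" using T less.prems(1) finite_subset by blast
    define N where "N = (\<Union>x\<in>T. R x)"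
    have "\<exists>f. inj_on f T \<and> (\<forall>x\<in>T. f x \<in> R x)"
    proof (rule less.hyps[OF psubset_card_mono[OF less.prems(1) T(1)] finT])
      show "finite (R x)" if "x \<in> T" for x using that T(1) less.prems(2) by blast
      show "card U \<le> card (\<Union>x\<in>U. R x)" if "U \<subseteq> T" for U
        using that T(1) by (intro less.prems(3)) auto
    qed
    then obtain f where f: "inj_on f T" "\<forall>x\<in>T. f x \<in> R x" by blast
    have small: "card (S - T) < card S"
      using T less.prems(1) finT by (intro psubset_card_mono) auto
    have hall: "card U \<le> card (\<Union>x\<in>U. R x - N)" if U: "U \<subseteq> S - T" for U
    proof -
      have finU: "finite U" using U less.prems(1) finite_subset by blast
      have "card U + card T = card (U \<union> T)" using U finU finT by (subst card_Un_disjoint) auto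
      also have "\<dots> \<le> card (\<Union>x\<in>U \<union> T. R x)" using U T by (intro less.prems(3)) auto
      also have "(\<Union>x\<in>U \<union> T. R x) = (\<Union>x\<in>U. R x - N) \<union> N" by (auto simp: N_def)
      also have "card \<dots> \<le> card (\<Union>x\<in>U. R x - N) + card N" by (rule card_Un_le)
      finally show ?thesis using T(3) by (simp add: N_def)
    qed
    have "\<exists>g. inj_on g (S - T) \<and> (\<forall>x\<in>S - T. g x \<in> R x - N)"
      using less.prems(1,2) hall by (intro less.hyps[OF small]) auto
    then obtain g where g: "inj_on g (S - T)" "\<forall>x\<in>S - T. g x \<in> R x - N" by blast
    define h where "h x = (if x \<in> T then f x else g x)" for x
    have fN: "f x \<in> N" if "x \<in> T" for x using f that by (auto simp: N_def)
    have "inj_on h S"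
    proof (rule inj_onI)
      fix x y assume xy: "x \<in> S" "y \<in> S" "h x = h y"
      have "x \<in> T \<longleftrightarrow> y \<in> T" using fN g(2) xy by (metis DiffD2 DiffI h_def)
      then show "x = y"
        using xy inj_onD[OF f(1), of x y] inj_onD[OF g(1), of x y] by (cases "x \<in> T") (simp_all add: h_def)
    qed
    moreover have "\<forall>x\<in>S. h x \<in> R x" using f g by (auto simp: h_def)
    ultimately show ?thesis by blast
  next
    case notight: False
    show ?thesis
    proof (cases "S = {}")
      case ne: False
      then obtain x where x: "x \<in> S" by blast
      have "card {x} \<le> card (\<Union>z\<in>{x}. R z)" using x by (intro less.prems(3)) auto
      then obtain y where y: "y \<in> R x" by fastforce
      have small: "card (S - {x}) < card S" using x less.prems(1) by (meson card_Diff1_less)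
      have hall: "card U \<le> card (\<Union>z\<in>U. R z - {y})" if U: "U \<subseteq> S - {x}" for U
      proof (cases "U = {}")
        case False
        have "U \<subset> S" using U x by blast
        then have "card U \<noteq> card (\<Union>z\<in>U. R z)" using False notight by blast
        moreover have "card U \<le> card (\<Union>z\<in>U. R z)" using \<open>U \<subset> S\<close> by (intro less.prems(3)) auto
        moreover have "card (\<Union>z\<in>U. R z) - 1 \<le> card (\<Union>z\<in>U. R z - {y})"
        proof -
          have "(\<Union>z\<in>U. R z - {y}) = (\<Union>z\<in>U. R z) - {y}" by auto
          then show ?thesis by (simp add: card_Diff_singleton_if)
        qed
        ultimately show ?thesis by linarith
      qed simp
      have "\<exists>g. inj_on g (S - {x}) \<and> (\<forall>z\<in>S - {x}. g z \<in> R z - {y})"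
        using less.prems(1,2) hall by (intro less.hyps[OF small]) auto
      then obtain g where g: "inj_on g (S - {x})" "\<forall>z\<in>S - {x}. g z \<in> R z - {y}" by blast
      have "inj_on (g(x := y)) S"
      proof (rule inj_onI)
        fix a b assume "a \<in> S" "b \<in> S" "(g(x := y)) a = (g(x := y)) b"
        then show "a = b"
          using bspec[OF g(2), of a] bspec[OF g(2), of b] inj_onD[OF g(1), of a b]
          by (cases "a = x"; cases "b = x") auto
      qed
      moreover have "\<forall>z\<in>S. (g(x := y)) z \<in> R z" using g y by auto
      ultimately show ?thesis by blast
    qed simp
  qed
qed

section \<open>Pursuit by successive teams\<close>

text \<open>Every \<open>w\<close> takes a cop from its own set; disjointness makes these cops
  distinct.\<close>

lemma guards_if_hit:
  assumes graph: "graph_on n E"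
    and disj: "\<And>w w'. w \<in> S \<Longrightarrow> w' \<in> S \<Longrightarrow> w \<noteq> w' \<Longrightarrow> W w \<inter> W w' = {}"
    and sub: "\<And>w. w \<in> S \<Longrightarrow> W w \<subseteq> nbhd E {w} t"
    and hit: "\<And>w. w \<in> S \<Longrightarrow> W w \<inter> set zs \<noteq> {}"
  shows "guards E zs S t"
proof -
  have "\<exists>i<length zs. zs ! i \<in> W w" if "w \<in> S" for w
    using hit[OF that] by (auto simp: in_set_conv_nth)
  then obtain g where g: "\<And>w. w \<in> S \<Longrightarrow> g w < length zs \<and> zs ! g w \<in> W w" by metis
  have "inj_on g S"
    using g disj by (intro inj_onI) (metis IntI empty_iff)
  moreover have "w \<in> nbhd E {zs ! g w} t" if "w \<in> S" for w
    using nbhd_sym[OF graph] g[OF that] sub[OF that] by blast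
  ultimately show ?thesis using g unfolding guards_def by blast
qed

text \<open>A state \<open>(p, r, A)\<close>: the robber is at \<open>p\<close>, and \<open>A\<close> is the part of the sphere of radius \<open>r\<close>
  around \<open>p\<close> that is not guarded.\<close>
definition state_at :: "nat \<Rightarrow> (nat \<Rightarrow> nat \<Rightarrow> bool) \<Rightarrow> nat set \<Rightarrow> real \<Rightarrow> real \<Rightarrow> (nat \<Rightarrow> nat) \<Rightarrow> nat
    \<Rightarrow> nat \<Rightarrow> nat \<times> nat \<times> nat set \<Rightarrow> bool" where
  "state_at n E X d a R \<mu> k = (\<lambda>(p, r, A). p \<in> {..<n} - X \<and> \<mu> \<le> r \<and> r + \<mu> \<le> R k \<and>
     A \<subseteq> sphere E {p} r - X \<and> real (card A) \<le> a * d ^ r / 16 ^ k)"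

text \<open>The teams \<open>k, k + 1, \<dots>\<close> depend only on the set \<open>\<S>\<close> of states that the earlier teams allow
  at level \<open>k\<close>; the induction runs backwards from level \<open>K\<close>, where \<open>\<S>\<close> is arbitrary.\<close>
lemma exists_teams:
  fixes E :: "nat \<Rightarrow> nat \<Rightarrow> bool" and \<omega> :: "nat \<Rightarrow> real" and a d :: real
  defines "\<beta> \<equiv> \<lambda>k r. a * d ^ r / (2 * 16 ^ Suc k)"
  assumes graph: "graph_on n E" and n: "n > 0" and xs: "set xs = X"
    and \<mu>: "\<mu> \<ge> 1" and R: "\<And>k. R k \<le> R (Suc k)"
    and pos: "a > 0" "d > 0"
    and ball: "\<And>k p r. k < K \<Longrightarrow> p \<in> {..<n} - X \<Longrightarrow> 1 \<le> r \<Longrightarrow> \<mu> \<le> r \<Longrightarrow> r + \<mu> \<le> R k \<Longrightarrow>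
       card (nbhd E {p} (r - 1)) \<le> m"
    and final: "\<And>k p r A cl gs zs. k \<le> K \<Longrightarrow> state_at n E X d a R \<mu> k (p, r, A) \<Longrightarrow>
       real (card A) \<le> \<theta> \<Longrightarrow>
       reaches E cl ({..<n} - X) \<Longrightarrow> set cl \<subseteq> {..<n} \<Longrightarrow> length cl = m \<Longrightarrow>
       guards E gs (sphere E {p} r - A - X) (Suc r) \<Longrightarrow> cw_cops E (xs @ cl @ gs @ zs @ fin) p"
    and access: "\<And>k p r A. k < K \<Longrightarrow> state_at n E X d a R \<mu> k (p, r, A) \<Longrightarrow> \<theta> < real (card A) \<Longrightarrow>
       \<exists>W Q. (\<forall>v\<in>A. real (card (sphere E {v} (R k - r))) \<le> a * d ^ (R k - r) \<and>
                    real (card (sphere E {v} (R k - r) \<inter> Q)) \<le> \<beta> k (R k - r)) \<and>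
         (\<forall>w\<in>(\<Union>v\<in>A. sphere E {v} (R k - r)) - Q. \<forall>w'\<in>(\<Union>v\<in>A. sphere E {v} (R k - r)) - Q.
            w \<noteq> w' \<longrightarrow> W w \<inter> W w' = {}) \<and>
         (\<forall>w\<in>(\<Union>v\<in>A. sphere E {v} (R k - r)) - Q. W w \<subseteq> {..<n} \<and> W w \<subseteq> nbhd E {w} (Suc (R k)) \<and>
            \<omega> k \<le> real (card (W w)))"
    and last: "\<And>p r A. state_at n E X d a R \<mu> K (p, r, A) \<Longrightarrow> real (card A) \<le> \<theta>"
    and union_bound: "\<And>k r. k < K \<Longrightarrow> \<mu> \<le> r \<Longrightarrow> r + \<mu> \<le> R k \<Longrightarrow>
       real n ^ (k + 2) * (exp 1 * (a * d ^ r) / real (nat \<lceil>\<beta> k r\<rceil>) *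
         exp (- (\<omega> k * real (M k) / real n))) ^ nat \<lceil>\<beta> k r\<rceil> < 1"
    and "k \<le> K" and "finite \<S>" "card \<S> \<le> n ^ Suc k" "\<And>s. s \<in> \<S> \<Longrightarrow> state_at n E X d a R \<mu> k s"
  shows "\<exists>Zs. set Zs \<subseteq> {..<n} \<and> length Zs = (\<Sum>j\<in>{k..<K}. M j) \<and>
    (\<forall>(p, r, A)\<in>\<S>. \<forall>cl gs. reaches E cl ({..<n} - X) \<longrightarrow> set cl \<subseteq> {..<n} \<longrightarrow> length cl = m \<longrightarrow>
       guards E gs (sphere E {p} r - A - X) (Suc r) \<longrightarrow> cw_cops E (xs @ cl @ gs @ Zs @ fin) p)"
  using \<open>k \<le> K\<close> assms(15-)
proof (induction k arbitrary: \<S> rule: inc_induct)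
  case base
  have "cw_cops E (xs @ cl @ gs @ [] @ fin) p"
    if "(p, r, A) \<in> \<S>" "reaches E cl ({..<n} - X)" "set cl \<subseteq> {..<n}" "length cl = m"
       "guards E gs (sphere E {p} r - A - X) (Suc r)" for p r A cl gs
    by (rule final[OF order_refl base(3)[OF that(1)] last[OF base(3)[OF that(1)]] that(2-)])
  then show ?case by (intro exI[of _ "[]"]) auto
next
  case (step k)
  \<comment> \<open>States with at most \<open>\<theta>\<close> unguarded vertices are left to the
    team \<open>fin\<close>; only the others concern the new team.\<close>
  define Big where "Big = {s\<in>\<S>. \<theta> < real (card (snd (snd s)))}"
  \<comment> \<open>The radius of the next ball, chosen so that two successive radii add up to
    \<open>R k\<close>.\<close>
  define h where "h s = R k - fst (snd s)" for s :: "nat \<times> nat \<times> nat set"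
  define U where "U s = (\<Union>v\<in>snd (snd s). sphere E {v} (h s))" for s :: "nat \<times> nat \<times> nat set"
  have stt: "state_at n E X d a R \<mu> k s" if "s \<in> \<S>" for s
    using step.prems(3) that by blast
  define good where "good s W Q \<longleftrightarrow>
      (\<forall>v\<in>snd (snd s). real (card (sphere E {v} (h s))) \<le> a * d ^ h s \<and>
         real (card (sphere E {v} (h s) \<inter> Q)) \<le> \<beta> k (h s)) \<and>
      (\<forall>w\<in>U s - Q. \<forall>w'\<in>U s - Q. w \<noteq> w' \<longrightarrow> W w \<inter> W w' = {}) \<and>
      (\<forall>w\<in>U s - Q. W w \<subseteq> {..<n} \<and> W w \<subseteq> nbhd E {w} (Suc (R k)) \<and> \<omega> k \<le> real (card (W w)))"
    for s :: "nat \<times> nat \<times> nat set" and W Q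
  have "\<forall>s\<in>Big. \<exists>WQ. good s (fst WQ) (snd WQ)"
  proof
    fix s assume s: "s \<in> Big"
    obtain p r A where prA: "s = (p, r, A)" by (cases s) auto
    have "state_at n E X d a R \<mu> k (p, r, A)" "\<theta> < real (card A)"
      using stt[of s] s prA by (auto simp: Big_def)
    from access[OF step.hyps(2) this] obtain W Q where "good s W Q"
      unfolding good_def prA h_def U_def fst_conv snd_conv by blast
    then show "\<exists>WQ. good s (fst WQ) (snd WQ)" by (intro exI[of _ "(W, Q)"]) simp
  qed
  from bchoice[OF this] obtain WQ where "\<forall>s\<in>Big. good s (fst (WQ s)) (snd (WQ s))" ..
  then have good: "good s (fst (WQ s)) (snd (WQ s))" if "s \<in> Big" for s using that by (rule bspec)
  have WQ1: "real (card (sphere E {v} (h s))) \<le> a * d ^ h s"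
    "real (card (sphere E {v} (h s) \<inter> snd (WQ s))) \<le> \<beta> k (h s)"
    if "s \<in> Big" "v \<in> snd (snd s)" for s v
    using good[OF that(1)] that(2) unfolding good_def by simp_all
  have WQ2: "fst (WQ s) w \<inter> fst (WQ s) w' = {}"
    if "s \<in> Big" "w \<in> U s - snd (WQ s)" "w' \<in> U s - snd (WQ s)" "w \<noteq> w'" for s w w'
    using good[OF that(1)] that(2-) unfolding good_def by blast
  have WQ3: "fst (WQ s) w \<subseteq> {..<n}" "fst (WQ s) w \<subseteq> nbhd E {w} (Suc (R k))"
    "\<omega> k \<le> real (card (fst (WQ s) w))" if "s \<in> Big" "w \<in> U s - snd (WQ s)" for s w
    using good[OF that(1)] that(2) unfolding good_def by blast+
  note WQ = WQ1 WQ2 WQ3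
  \<comment> \<open>The situations for which the new team must be good: a state and the unguarded
    vertex at which the robber leaves the ball. Each state offers at most \<open>n\<close> such
    vertices, hence the bound \<open>n ^ (k + 2)\<close>.\<close>
  define I where "I = (SIGMA s:Big. snd (snd s))"
  define T where "T = (\<lambda>(s, v). sphere E {v} (h s) - snd (WQ s))"
  have sph: "sphere E {v} r \<subseteq> {..<n}" if "v < n" for v r
    using order_trans[OF sphere_subset_nbhd nbhd_subset[OF graph, of "{v}"]] that by simp
  have An: "snd (snd s) \<subseteq> {..<n} - X" if "s \<in> Big" for s
    using stt[of s] that sph by (fastforce simp: Big_def state_at_def split: prod.splits)
  have hs: "\<mu> \<le> h s" "h s + \<mu> \<le> R k" "fst (snd s) + h s = R k" "\<mu> \<le> fst (snd s)" if "s \<in> \<S>" for s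
    using stt[OF that] by (auto simp: h_def state_at_def split: prod.splits)
  have BigS: "Big \<subseteq> \<S>" by (auto simp: Big_def)
  have finA: "finite (snd (snd s))" if "s \<in> Big" for s
    using finite_subset[OF An[OF that]] by simp
  have finI: "finite I"
    unfolding I_def using finite_subset[OF BigS step.prems(1)] finA by (rule finite_SigmaI)
  have "card I \<le> card (\<S> \<times> {..<n})"
  proof (rule card_mono)
    show "I \<subseteq> \<S> \<times> {..<n}" unfolding I_def using BigS An by blast
  qed (use step.prems(1) in simp)
  also have "\<dots> \<le> n ^ Suc k * n" using step.prems(2) by (simp add: card_cartesian_product)
  finally have cardI: "card I \<le> n ^ (k + 2)" by (simp add: mult_ac)
  have \<beta>pos: "\<beta> k r > 0" for r using pos by (simp add: \<beta>_def)
  have "\<exists>zs. length zs = M k \<and> set zs \<subseteq> {..<n} \<and>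
           (\<forall>i\<in>I. card {w\<in>T i. fst (WQ (fst i)) w \<inter> set zs = {}} < nat \<lceil>\<beta> k (h (fst i))\<rceil>)"
  proof (rule exists_list_hitting_most[where m = "\<lambda>i. a * d ^ h (fst i)" and \<omega> = "\<lambda>_. \<omega> k", OF n finI])
    fix i assume i: "i \<in> I"
    obtain s v where sv: "i = (s, v)" by (cases i)
    have s: "s \<in> Big" "v \<in> snd (snd s)" using i sv by (auto simp: I_def)
    have TU: "T i \<subseteq> U s - snd (WQ s)" using s by (auto simp: T_def U_def sv)
    have fs: "finite (sphere E {v} (h s))"
      using sph[of v] An[OF s(1)] s(2) finite_subset by blast
    show "finite (T i)" using fs by (simp add: T_def sv)
    have "card (T i) \<le> card (sphere E {v} (h s))" unfolding T_def sv using fs by (auto intro: card_mono)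
    then show "real (card (T i)) \<le> a * d ^ h (fst i)" using WQ(1)[OF s] by (simp add: sv)
    show "nat \<lceil>\<beta> k (h (fst i))\<rceil> > 0" using \<beta>pos by simp
    show "fst (WQ (fst i)) w \<subseteq> {..<n}" "\<omega> k \<le> real (card (fst (WQ (fst i)) w))" if "w \<in> T i" for w
      using WQ(4,6)[OF s(1)] TU that by (auto simp: sv)
    show "fst (WQ (fst i)) w \<inter> fst (WQ (fst i)) w' = {}" if "w \<in> T i" "w' \<in> T i" "w \<noteq> w'" for w w'
      using WQ(3)[OF s(1), of w w'] TU that by (auto simp: sv)
    have sS: "s \<in> \<S>" using s BigS by blast
    let ?q = "(exp 1 * (a * d ^ h s) / real (nat \<lceil>\<beta> k (h s)\<rceil>) *
         exp (- (\<omega> k * real (M k) / real n))) ^ nat \<lceil>\<beta> k (h s)\<rceil>"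
    have "real (card I) * ?q \<le> real n ^ (k + 2) * ?q"
    proof (rule mult_right_mono)
      show "real (card I) \<le> real n ^ (k + 2)" using cardI of_nat_le_iff by (metis of_nat_power)
      show "?q \<ge> 0" using pos by simp
    qed
    also have "\<dots> < 1" by (rule union_bound[OF step.hyps(2) hs(1,2)[OF sS]])
    finally show "real (card I) * (exp 1 * (a * d ^ h (fst i)) / real (nat \<lceil>\<beta> k (h (fst i))\<rceil>) *
         exp (- (\<omega> k * real (M k) / real n))) ^ nat \<lceil>\<beta> k (h (fst i))\<rceil> < 1" by (simp add: sv)
  qed
  then obtain zs where zs: "length zs = M k" "set zs \<subseteq> {..<n}"
    "\<And>i. i \<in> I \<Longrightarrow> card {w\<in>T i. fst (WQ (fst i)) w \<inter> set zs = {}} < nat \<lceil>\<beta> k (h (fst i))\<rceil>"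
    by blast
  define miss where "miss s = {w\<in>U s - snd (WQ s). fst (WQ s) w \<inter> set zs = {}}" for s
  \<comment> \<open>The unguarded part of the next sphere consists of exceptional vertices and of
    vertices whose set contains no cop. Each kind has at most \<open>\<beta>\<close> members, half
    of what level \<open>k + 1\<close> allows.\<close>
  define F where "F = (\<lambda>(s, v). sphere E {v} (h s) \<inter> (snd (WQ s) \<union> miss s) - X)"
  define \<S>' where "\<S>' = (\<lambda>i. (snd i, h (fst i), F i)) ` I"
  have st': "state_at n E X d a R \<mu> (Suc k) s'" if s': "s' \<in> \<S>'" for s'
  proof -
    obtain i where "i \<in> I" "s' = (snd i, h (fst i), F i)" using s' by (auto simp: \<S>'_def)
    then obtain s v where sv: "(s, v) \<in> I" "s' = (v, h s, F (s, v))" by (cases i) simp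
    have s: "s \<in> Big" "v \<in> snd (snd s)" "s \<in> \<S>" using sv BigS by (auto simp: I_def)
    have v: "v < n" "v \<notin> X" using An[OF s(1)] s(2) by auto
    have "F (s, v) \<subseteq> (sphere E {v} (h s) \<inter> snd (WQ s)) \<union> {w\<in>T (s, v). fst (WQ s) w \<inter> set zs = {}}"
      by (auto simp: F_def T_def miss_def)
    moreover have fin: "finite (sphere E {v} (h s))" using sph[OF v(1)] finite_subset by blast
    ultimately have "card (F (s, v)) \<le> card ((sphere E {v} (h s) \<inter> snd (WQ s)) \<union> {w\<in>T (s, v). fst (WQ s) w \<inter> set zs = {}})"
      by (intro card_mono) (auto simp: T_def)
    also have "\<dots> \<le> card (sphere E {v} (h s) \<inter> snd (WQ s)) + card {w\<in>T (s, v). fst (WQ s) w \<inter> set zs = {}}"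
      by (rule card_Un_le)
    finally have "real (card (F (s, v))) \<le> real (card (sphere E {v} (h s) \<inter> snd (WQ s))) + real (card {w\<in>T (s, v). fst (WQ s) w \<inter> set zs = {}})"
      by linarith
    moreover have "real (card {w\<in>T (s, v). fst (WQ s) w \<inter> set zs = {}}) \<le> \<beta> k (h s)"
      using zs(3)[OF sv(1)] \<beta>pos[of "h s"] by simp linarith
    ultimately have "real (card (F (s, v))) \<le> \<beta> k (h s) + \<beta> k (h s)"
      using WQ(2)[OF s(1,2)] by linarith
    then have "real (card (F (s, v))) \<le> a * d ^ h s / 16 ^ Suc k" by (simp add: \<beta>_def)
    moreover have "h s + \<mu> \<le> R (Suc k)" using hs(2)[OF s(3)] R[of k] by linarith
    ultimately show ?thesis using hs(1)[OF s(3)] v by (auto simp: state_at_def sv(2) F_def)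
  qed
  have fin': "finite \<S>'" using finI by (simp add: \<S>'_def)
  have card': "card \<S>' \<le> n ^ Suc (Suc k)"
    unfolding \<S>'_def using order_trans[OF card_image_le[OF finI] cardI] by simp
  obtain Zs where Zs: "set Zs \<subseteq> {..<n}" "length Zs = (\<Sum>j\<in>{Suc k..<K}. M j)"
    and all_win: "\<forall>(p, r, A)\<in>\<S>'. \<forall>cl gs. reaches E cl ({..<n} - X) \<longrightarrow> set cl \<subseteq> {..<n} \<longrightarrow> length cl = m \<longrightarrow>
       guards E gs (sphere E {p} r - A - X) (Suc r) \<longrightarrow> cw_cops E (xs @ cl @ gs @ Zs @ fin) p"
    by (rule exE[OF step.IH[OF fin' card' st']], assumption, elim conjE) blast
  have win: "cw_cops E (xs @ cl @ gs @ Zs @ fin) p"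
    if "(p, r, A) \<in> \<S>'" "reaches E cl ({..<n} - X)" "set cl \<subseteq> {..<n}" "length cl = m"
       "guards E gs (sphere E {p} r - A - X) (Suc r)" for p r A cl gs
    using bspec[OF all_win that(1)] that(2-) by simp
  have "cw_cops E (xs @ cl @ gs @ (zs @ Zs) @ fin) p"
    if s: "(p, r, A) \<in> \<S>" and cl: "reaches E cl ({..<n} - X)" "set cl \<subseteq> {..<n}" "length cl = m"
      and gs: "guards E gs (sphere E {p} r - A - X) (Suc r)" for p r A cl gs
  proof (cases "real (card A) \<le> \<theta>")
    case True
    then show ?thesis using step.hyps(2) by (intro final[OF _ stt[OF s] True cl gs]) auto
  next
    case False
    define s where "s = (p, r, A)"
    have sBig: "s \<in> Big" using False s by (auto simp: Big_def s_def)
    have sS: "s \<in> \<S>" using s s_def by simp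
    have p: "p \<in> {..<n} - X" using stt[OF sS] by (simp add: state_at_def s_def)
    have r: "1 \<le> r" "\<mu> \<le> r" "r + \<mu> \<le> R k" using stt[OF sS] \<mu> by (auto simp: state_at_def s_def)
    have guard: "guards E zs (U s - snd (WQ s) - miss s) (Suc (R k))"
      using WQ(3,5)[OF sBig] by (intro guards_if_hit[OF graph, where W = "fst (WQ s)"]) (auto simp: miss_def)
    \<comment> \<open>The time budget of the new team: \<open>r\<close> rounds while the robber
      leaves the present ball, \<open>h s\<close> for the next one, and one capturing move.\<close>
    have Rk: "Suc (R k) = r + Suc (h s)" using hs(3)[OF sS] by (simp add: s_def)
    have "cw_cops E (xs @ cl @ gs @ zs @ (Zs @ fin)) p"
    proof (rule robber_in_ball[OF graph xs p r(1) cl(1,2) _ gs])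
      show "card (nbhd E {p} (r - 1)) \<le> length cl"
        using ball[OF step.hyps(2) p r] cl(3) by simp
      show "guards E zs (U s - snd (WQ s) - miss s) (r + Suc (h s))" using guard unfolding Rk .
      fix v cl' gs' zs'
      assume v: "v \<in> A - X" and cl': "reaches E cl' ({..<n} - X)" "set cl' \<subseteq> {..<n}" "length cl' = length cl"
        and g: "guards E zs' (U s - snd (WQ s) - miss s) (Suc (h s))"
      have vI: "(s, v) \<in> I" using v sBig by (auto simp: I_def s_def)
      have "sphere E {v} (h s) - F (s, v) - X \<subseteq> U s - snd (WQ s) - miss s"
        using v by (auto simp: F_def U_def s_def)
      \<comment> \<open>At the next level the present team takes over as \<open>gs\<close>. The
        former guards remain in the list as idle members.\<close>
      then have "guards E (gs' @ zs') (sphere E {v} (h s) - F (s, v) - X) (Suc (h s))"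
        by (intro guards_append guards_subset[OF g])
      moreover have "(v, h s, F (s, v)) \<in> \<S>'" unfolding \<S>'_def using vI by force
      ultimately show "cw_cops E (xs @ cl' @ gs' @ zs' @ Zs @ fin) v"
        using win[of v "h s" "F (s, v)" cl' "gs' @ zs'"] cl' cl(3) by simp
    qed
    then show ?thesis by simp
  qed
  moreover have "set (zs @ Zs) \<subseteq> {..<n}" using zs Zs by auto
  moreover have "length (zs @ Zs) = (\<Sum>j\<in>{k..<K}. M j)"
    using zs Zs step.hyps(2) by (simp add: sum.atLeast_Suc_lessThan)
  ultimately show ?case by (intro exI[of _ "zs @ Zs"]) blast
qed

section \<open>Sparse expanders of a fixed size\<close>

text \<open>Hall's theorem assigns distinct occupied vertices, and choosing a list position for each
  of them keeps the assignment injective.\<close>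

lemma guards_if_hall:
  assumes graph: "graph_on n E" and S: "finite S"
    and hall: "\<And>V. V \<subseteq> S \<Longrightarrow> card V \<le> card (set zs \<inter> sphere E V t)"
  shows "guards E zs S t"
proof -
  have "\<exists>f. inj_on f S \<and> (\<forall>w\<in>S. f w \<in> set zs \<inter> nbhd E {w} t)"
  proof (rule hall_marriage[OF S])
    fix V assume V: "V \<subseteq> S"
    have "sphere E V t \<subseteq> (\<Union>w\<in>V. nbhd E {w} t)"
      using sphere_subset_nbhd[of E V t] nbhd_UN[of E V t] by simp
    then have "set zs \<inter> sphere E V t \<subseteq> (\<Union>w\<in>V. set zs \<inter> nbhd E {w} t)" by blast
    then have "card (set zs \<inter> sphere E V t) \<le> card (\<Union>w\<in>V. set zs \<inter> nbhd E {w} t)"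
      using finite_subset[OF V S] by (intro card_mono) auto
    then show "card V \<le> card (\<Union>w\<in>V. set zs \<inter> nbhd E {w} t)" using hall[OF V] by linarith
  qed auto
  then obtain f where f: "inj_on f S" "\<And>w. w \<in> S \<Longrightarrow> f w \<in> set zs \<inter> nbhd E {w} t" by blast
  have "\<exists>i<length zs. zs ! i = f w" if "w \<in> S" for w
    using f(2)[OF that] by (auto simp: in_set_conv_nth)
  then obtain g where g: "\<And>w. w \<in> S \<Longrightarrow> g w < length zs \<and> zs ! g w = f w" by metis
  have "inj_on g S"
    using g inj_onD[OF f(1)] by (intro inj_onI) metis
  moreover have "w \<in> nbhd E {zs ! g w} t" if "w \<in> S" for w
    using nbhd_sym[OF graph] g[OF that] f(2)[OF that] by auto
  ultimately show ?thesis using g unfolding guards_def by blast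
qed

text \<open>Two stages in a row. The team \<open>zs\<close> fences the entire second sphere outside
  \<open>X\<close>, whichever \<open>v\<close> in \<open>A\<close> the robber has chosen, so the
  second stage has no unguarded part.\<close>

lemma final_capture:
  assumes graph: "graph_on n E" and xs: "set xs = X" and p: "p \<in> {..<n} - X"
    and r: "1 \<le> r" "1 \<le> s" and A: "A \<inter> X = {}"
    and cl: "reaches E cl ({..<n} - X)" "set cl \<subseteq> {..<n}"
      "card (nbhd E {p} (r - 1)) \<le> length cl"
      "\<And>v. v \<in> A \<Longrightarrow> v < n \<Longrightarrow> card (nbhd E {v} (s - 1)) \<le> length cl"
    and gs: "guards E gs (sphere E {p} r - A - X) (Suc r)"
    and zs: "guards E zs ((\<Union>v\<in>A. sphere E {v} s) - X) (r + Suc s)"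
  shows "cw_cops E (xs @ cl @ gs @ zs @ rest) p"
proof (rule robber_in_ball[OF graph xs p r(1) cl(1-3) gs zs])
  fix v cl' gs' zs'
  assume v: "v \<in> A - X" "v < n" and cl': "reaches E cl' ({..<n} - X)" "set cl' \<subseteq> {..<n}" "length cl' = length cl"
    and zs': "guards E zs' ((\<Union>v\<in>A. sphere E {v} s) - X) (Suc s)"
  have "cw_cops E (xs @ cl' @ (gs' @ zs') @ [] @ rest) v"
  proof (rule robber_in_ball[OF graph xs _ r(2) cl'(1,2), where A = "{}" and S = "{}" and t = 0])
    show "v \<in> {..<n} - X" using v by auto
    show "card (nbhd E {v} (s - 1)) \<le> length cl'" using cl(4) v cl'(3) by auto
    show "guards E (gs' @ zs') (sphere E {v} s - {} - X) (Suc s)"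
      using v by (intro guards_append guards_subset[OF zs']) auto
    show "guards E [] {} (s + 0)" by (rule guards_empty)
  qed auto
  then show "cw_cops E (xs @ cl' @ gs' @ zs' @ rest) v" by simp
qed

lemma power_bracket:
  fixes d x :: real
  assumes "d > 1" "x \<ge> 1"
  shows "\<exists>r. d ^ r \<le> x \<and> x < d ^ Suc r"
proof -
  have ex: "\<exists>r. x < d ^ r" by (rule real_arch_pow[OF assms(1)])
  define s where "s = (LEAST r. x < d ^ r)"
  have s: "x < d ^ s" unfolding s_def by (rule LeastI_ex[OF ex])
  have "s \<noteq> 0" using s assms(2) by (metis not_le power_0)
  then obtain r where r: "s = Suc r" using not0_implies_Suc by blast
  have "\<not> x < d ^ r" using not_less_Least[of r "\<lambda>r. x < d ^ r"] r s_def by simp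
  then show ?thesis using s r by (intro exI[of _ r]) auto
qed

lemma sum_power_le_power:
  fixes d :: real
  assumes "d \<ge> 2"
  shows "(\<Sum>i<r. d ^ i) \<le> d ^ r"
proof (induction r)
  case (Suc r)
  have "2 * d ^ r \<le> d * d ^ r" using assms by (intro mult_right_mono) auto
  then show ?case using Suc by simp
qed simp

lemma nbhd_eq_UN_sphere: "nbhd E S r = (\<Union>i\<le>r. sphere E S i)"
  by (induction r) (auto simp: atMost_Suc)

text \<open>The hypotheses for one fixed graph, together with inequalities that hold for large
  \<open>n\<close>. The unit of slack is \<open>\<sigma>\<close>: a factor \<open>d\<close> or a
  constant from \<open>const_le\<close> costs at most \<open>n\<close> to the power
  \<open>\<sigma>\<close>, and \<open>\<delta>\<close> has room for 20 such units.\<close>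

locale sparse_expander =
  fixes n :: nat and E :: "nat \<Rightarrow> nat \<Rightarrow> bool" and X :: "nat set"
    and d J \<delta> \<sigma> a1 a2 a3 a4 a5 :: real
  assumes graph: "graph_on n E" and X: "X \<subseteq> {..<n}" and d: "d \<ge> 2"
    and pos: "a1 > 0" "a2 > 0" "a3 > 0" "a4 > 0" "a5 > 0"
    and spheres: "\<And>v r r' V'. v \<in> {..<n} - X \<Longrightarrow> r \<ge> 1 \<Longrightarrow> d ^ r < real n powr (1/2 + \<delta>) \<Longrightarrow>
        r' \<ge> 1 \<Longrightarrow> d ^ r' < real n powr (1/2 + \<delta>) \<Longrightarrow> V' \<subseteq> nbhd E {v} r - X \<Longrightarrow>
        real (card V') * d ^ r' \<le> real n / ln (real n) powr J \<Longrightarrow>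
        a1 * real (card V') * d ^ r' \<le> real (card (sphere E V' r')) \<and>
        real (card (sphere E V' r')) \<le> a2 * real (card V') * d ^ r'"
    and access: "\<And>r r' v A.
        real n powr (1/4 - \<delta>) < (d + 1) * d ^ r \<Longrightarrow> (d + 1) * d ^ r < real n powr (1/4 + \<delta>) \<Longrightarrow>
        real n powr (1/4 - \<delta>) < (d + 1) * d ^ r' \<Longrightarrow> (d + 1) * d ^ r' < real n powr (1/4 + \<delta>) \<Longrightarrow>
        v \<in> {..<n} - X \<Longrightarrow> A \<subseteq> sphere E {v} r - X \<Longrightarrow> real (card A) > real n powr (1/4 - \<delta>) \<Longrightarrow>
        d ^ (r + r') < a3 * real n / real (card (\<Union>a\<in>A. sphere E {a} r')) \<Longrightarrow>
        \<exists>Q. (\<forall>a\<in>A. real (card (sphere E {a} r' \<inter> Q)) < real n powr (1/4 - 2*\<delta>)) \<and>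
            accessible E n d ((\<Union>a\<in>A. sphere E {a} r') - Q) (r + r' + 1) a4 a5"
    and conn: "\<And>u w. u \<in> {..<n} - X \<Longrightarrow> w \<in> {..<n} - X \<Longrightarrow> E\<^sup>*\<^sup>* u w"
    and \<sigma>: "\<sigma> > 0" "20 * \<sigma> \<le> \<delta>" "\<sigma> \<le> 1/400"
    and n: "n > 1"
    and d_le: "d \<le> real n powr \<sigma>"
    and log_le: "real n powr (1 - \<sigma>) \<le> real n / ln (real n) powr J"
    and const_le: "a2 \<le> real n powr \<sigma>" "32 / a2 \<le> real n powr \<sigma>" "16 \<le> real n powr \<sigma>"
      "sqrt a3 / (2 * a2) \<le> real n powr \<sigma>" "2 * a2 / sqrt a3 \<le> real n powr \<sigma>"
    and exp_small: "2 * real n ^ 3 * exp (1 - a1 * real n powr \<sigma>) \<le> 1"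
    and log_small: "(ln (real n) + 2) * ln (real n) < real n powr (1/8)"
begin

section \<open>Estimates by powers of n; sizes of spheres and balls\<close>

abbreviation P :: "real \<Rightarrow> real" where "P e \<equiv> real n powr e"

lemma n_pos [simp]: "0 < n"
  using n by simp

lemma P_pos [simp]: "P e > 0" "P e \<ge> 0" "P e \<noteq> 0"
  using n by simp_all

lemma P_mult: "P x * P y = P (x + y)"
  by (simp add: powr_add)

lemma P_mono: "x \<le> y \<Longrightarrow> P x \<le> P y"
  using n by (intro powr_mono) auto

lemma P_less: "x < y \<Longrightarrow> P x < P y"
  using n by (intro powr_less_mono) auto

lemma P_half: "P (1/2) = sqrt (real n)"
  by (rule powr_half_sqrt) simp

lemma P_le_multI: "x \<le> P e \<Longrightarrow> y \<le> P f \<Longrightarrow> 0 \<le> x \<Longrightarrow> e + f \<le> g \<Longrightarrow> x * y \<le> P g"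
proof -
  assume "x \<le> P e" "y \<le> P f" "0 \<le> x" "e + f \<le> g"
  have "x * y \<le> x * P f" using \<open>0 \<le> x\<close> \<open>y \<le> P f\<close> by (rule mult_left_mono[rotated])
  also have "\<dots> \<le> P e * P f" using \<open>x \<le> P e\<close> by (intro mult_right_mono) auto
  also have "\<dots> = P (e + f)" by (rule P_mult)
  also have "\<dots> \<le> P g" using \<open>e + f \<le> g\<close> by (rule P_mono)
  finally show ?thesis .
qed

lemma P_ge_multI: "P e \<le> x \<Longrightarrow> P f \<le> y \<Longrightarrow> g \<le> e + f \<Longrightarrow> P g \<le> x * y"
proof -
  assume "P e \<le> x" "P f \<le> y" "g \<le> e + f"
  have "P g \<le> P (e + f)" using \<open>g \<le> e + f\<close> by (rule P_mono)
  also have "\<dots> = P e * P f" by (rule P_mult[symmetric])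
  also have "\<dots> \<le> x * y" using \<open>P e \<le> x\<close> \<open>P f \<le> y\<close> by (intro mult_mono) (auto intro: order_trans[OF P_pos(2)])
  finally show ?thesis .
qed

lemma P_inverse_le: "x > 0 \<Longrightarrow> 1 / x \<le> P e \<Longrightarrow> P (- e) \<le> x"
  using n by (simp add: powr_minus inverse_eq_divide divide_le_eq mult.commute)

lemma sphere_upper:
  assumes v: "v \<in> {..<n} - X" and t: "t \<ge> 1" "d ^ t \<le> P (1/2)"
  shows "a1 * d ^ t \<le> real (card (sphere E {v} t))" "real (card (sphere E {v} t)) \<le> a2 * d ^ t"
proof -
  have lt: "x < P (1/2 + \<delta>)" if "x \<le> P (1/2)" for x
    using that P_less[of "1/2" "1/2 + \<delta>"] \<sigma> by linarith
  have "d ^ 1 \<le> P (1/2)" using d_le P_mono[of \<sigma> "1/2"] \<sigma> by simp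
  moreover have "v \<in> nbhd E {v} 1" by simp
  moreover have "real (card {v}) * d ^ t \<le> real n / ln (real n) powr J"
    using t(2) log_le P_mono[of "1/2" "1 - \<sigma>"] \<sigma> by simp
  ultimately have "a1 * real (card {v}) * d ^ t \<le> real (card (sphere E {v} t)) \<and>
        real (card (sphere E {v} t)) \<le> a2 * real (card {v}) * d ^ t"
    using v t lt by (intro spheres[of v 1]) auto
  then show "a1 * d ^ t \<le> real (card (sphere E {v} t))" "real (card (sphere E {v} t)) \<le> a2 * d ^ t"
    by auto
qed

text \<open>The size of the cleaning team.\<close>

definition m :: nat where "m = nat \<lfloor>sqrt (real n)\<rfloor>"

lemma ball_le_m:
  assumes v: "v \<in> {..<n} - X" and r: "r \<ge> 1" "d ^ r \<le> P (1/4 + 17 * \<sigma>)"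
  shows "card (nbhd E {v} (r - 1)) \<le> m"
proof -
  have "card (nbhd E {v} (r - 1)) \<le> (\<Sum>i\<le>r - 1. card (sphere E {v} i))"
    unfolding nbhd_eq_UN_sphere by (rule card_UN_le) simp
  also have "{..r - 1} = {..<r}" using r by auto
  finally have "real (card (nbhd E {v} (r - 1))) \<le> (\<Sum>i<r. real (card (sphere E {v} i)))"
    by (metis of_nat_le_iff of_nat_sum)
  \<comment> \<open>The summand 1 in \<open>1 + a2\<close> takes care of the centre, the sphere of
    radius 0. The geometric sum then puts the ball below \<open>n\<close> to the power
    \<open>1/4 + 19 * \<sigma>\<close>.\<close>
  also have "\<dots> \<le> (\<Sum>i<r. (1 + a2) * d ^ i)"
  proof (rule sum_mono)
    fix i assume i: "i \<in> {..<r}"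
    show "real (card (sphere E {v} i)) \<le> (1 + a2) * d ^ i"
    proof (cases "i = 0")
      case True
      then show ?thesis using pos by simp
    next
      case False
      have "d ^ i \<le> d ^ r" using i d by (intro power_increasing) auto
      also have "\<dots> \<le> P (1/2)" using r(2) P_mono[of "1/4 + 17 * \<sigma>" "1/2"] \<sigma> by linarith
      finally have "real (card (sphere E {v} i)) \<le> a2 * d ^ i" using sphere_upper(2)[OF v] False by simp
      then show ?thesis using d by (simp add: algebra_simps) (smt (verit) zero_le_power)
    qed
  qed
  also have "\<dots> = (1 + a2) * (\<Sum>i<r. d ^ i)" by (simp add: sum_distrib_left)
  also have "\<dots> \<le> (1 + a2) * d ^ r" using pos sum_power_le_power[OF d] by (intro mult_left_mono) auto
  also have "\<dots> \<le> P (1/2)"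
  proof (rule P_le_multI[OF _ r(2), of _ "2 * \<sigma>"])
    have "1 + a2 \<le> 2 * P \<sigma>" using const_le by linarith
    also have "\<dots> \<le> P (2 * \<sigma>)" using const_le by (intro P_le_multI[of _ \<sigma> _ \<sigma>]) auto
    finally show "1 + a2 \<le> P (2 * \<sigma>)" .
  qed (use pos \<sigma> in auto)
  finally show ?thesis unfolding P_half m_def by (simp add: le_nat_floor)
qed

section \<open>Radii and number of the stages\<close>

definition c0 :: real where "c0 = sqrt a3 / (2 * a2)"

text \<open>The last inequality, which holds with a factor 4 to spare, yields the upper bound on
  \<open>d ^ (r + r')\<close> required in \<open>access\<close>.\<close>

lemma c0: "c0 > 0" "c0 \<le> P \<sigma>" "P (- \<sigma>) \<le> c0" "a2\<^sup>2 * c0\<^sup>2 < a3"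
  using pos const_le P_inverse_le[of c0 \<sigma>] by (auto simp: c0_def power_divide power_mult_distrib)

text \<open>The value that \<open>d ^ R k\<close> approximates from below. The unguarded part
  shrinks like \<open>1 / 16 ^ k\<close>, so the growth by \<open>4 ^ k\<close> still keeps
  \<open>d ^ R k\<close> times the size of the union of next spheres of order
  \<open>n\<close>.\<close>

definition x :: "nat \<Rightarrow> real" where "x k = c0 * sqrt (real n) * 4 ^ k"

lemma x_ge_1: "x k \<ge> 1"
proof -
  have "P (- \<sigma> + 1/2) \<le> c0 * sqrt (real n)"
    using c0(3) P_half by (intro P_ge_multI[of "- \<sigma>" _ "1/2"]) auto
  moreover have "P 0 \<le> P (- \<sigma> + 1/2)" using \<sigma> by (intro P_mono) auto
  ultimately have "1 \<le> c0 * sqrt (real n)" using n by simp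
  moreover have "(1::real) \<le> 4 ^ k" by simp
  ultimately have "1 * 1 \<le> c0 * sqrt (real n) * 4 ^ k" by (intro mult_mono) auto
  then show ?thesis by (simp add: x_def)
qed

text \<open>The radii of two successive stages \<open>k\<close> and \<open>k + 1\<close> add up to \<open>R k\<close>.\<close>
definition R :: "nat \<Rightarrow> nat" where "R k = (SOME r. d ^ r \<le> x k \<and> x k < d ^ Suc r)"

lemma R: "d ^ R k \<le> x k" "x k < d ^ Suc (R k)"
  using someI_ex[OF power_bracket[OF _ x_ge_1[of k], of d]] d by (simp_all add: R_def)

lemma R_mono: "R k \<le> R (Suc k)"
proof (rule ccontr)
  assume "\<not> R k \<le> R (Suc k)"
  then have "d ^ Suc (R (Suc k)) \<le> d ^ R k" using d by (intro power_increasing) auto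
  then have "x (Suc k) < x k" using R(1)[of k] R(2)[of "Suc k"] by linarith
  moreover have "x (Suc k) = 4 * x k" by (simp add: x_def)
  ultimately show False using x_ge_1[of k] by linarith
qed

text \<open>The initial radius and a lower bound for all later ones. Radius \<open>r\<close> is
  followed by \<open>R k - r\<close>, so \<open>r + \<mu> \<le> R k\<close> hands the lower bound
  on, while \<open>\<mu> \<le> r\<close> and monotonicity of \<open>R\<close> hand on the upper
  bound.\<close>

definition \<mu> :: nat where "\<mu> = R 0 div 2"

text \<open>Rounding in \<open>R 0\<close> and in the halving costs at most
  \<open>d\<^sup>2\<close>, and \<open>c0\<close> costs another \<open>\<sigma>\<close>. So
  \<open>3 * \<sigma>\<close> is lost before the square root is taken.\<close>

lemma \<mu>: "P (1/4 - 2 * \<sigma>) \<le> d ^ \<mu>"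
proof (rule power2_le_imp_le)
  have "x 0 < d ^ Suc (R 0)" by (rule R)
  also have "\<dots> \<le> d ^ (2 + 2 * \<mu>)" using d by (intro power_increasing) (auto simp: \<mu>_def)
  also have "\<dots> = d\<^sup>2 * (d ^ \<mu>)\<^sup>2" by (simp only: power_add power_mult[symmetric] mult.commute)
  also have "\<dots> \<le> P (2 * \<sigma>) * (d ^ \<mu>)\<^sup>2"
    using d_le d unfolding power2_eq_square by (intro mult_right_mono P_le_multI[of _ \<sigma> _ \<sigma>]) auto
  finally have "x 0 \<le> P (2 * \<sigma>) * (d ^ \<mu>)\<^sup>2" by simp
  moreover have "P (1/2 - \<sigma>) \<le> x 0"
    using c0(3) P_half unfolding x_def by (simp, intro P_ge_multI[of "- \<sigma>" _ "1/2"]) auto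
  ultimately have "P (1/2 - \<sigma>) \<le> P (2 * \<sigma>) * (d ^ \<mu>)\<^sup>2" by linarith
  then have "P (- (2 * \<sigma>)) * P (1/2 - \<sigma>) \<le> P (- (2 * \<sigma>)) * (P (2 * \<sigma>) * (d ^ \<mu>)\<^sup>2)"
    by (intro mult_left_mono) auto
  also have "\<dots> = (P (- (2 * \<sigma>)) * P (2 * \<sigma>)) * (d ^ \<mu>)\<^sup>2" by (simp only: mult.assoc)
  also have "\<dots> = (d ^ \<mu>)\<^sup>2" using n by (simp only: P_mult) simp
  finally have "P (1/2 - 3 * \<sigma>) \<le> (d ^ \<mu>)\<^sup>2" by (simp add: P_mult)
  moreover have "(P (1/4 - 2 * \<sigma>))\<^sup>2 \<le> P (1/2 - 3 * \<sigma>)"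
    unfolding power2_eq_square P_mult using \<sigma> by (intro P_mono) auto
  ultimately show "(P (1/4 - 2 * \<sigma>))\<^sup>2 \<le> (d ^ \<mu>)\<^sup>2" by linarith
qed (use d in auto)

lemma \<mu>_ge_1: "\<mu> \<ge> 1"
proof (rule ccontr)
  assume "\<not> \<mu> \<ge> 1"
  then have "P (1/4 - 2 * \<sigma>) \<le> P 0" using \<mu> n by (simp add: not_le)
  moreover have "P 0 < P (1/4 - 2 * \<sigma>)" using \<sigma> by (intro P_less) auto
  ultimately show False by simp
qed

text \<open>The number of random stages. It makes \<open>16 ^ K\<close> equal to
  \<open>P (28 * \<sigma>)\<close> up to a factor 16, which offsets the excess of the sphere sizes
  over \<open>\<theta>\<close>.\<close>

definition K :: nat where "K = (SOME r. 4 ^ r \<le> P (14 * \<sigma>) \<and> P (14 * \<sigma>) < 4 ^ Suc r)"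

lemma K: "4 ^ K \<le> P (14 * \<sigma>)" "P (14 * \<sigma>) < 4 ^ Suc K"
proof -
  have "P 0 \<le> P (14 * \<sigma>)" using \<sigma> by (intro P_mono) auto
  then have "1 \<le> P (14 * \<sigma>)" using n by simp
  from someI_ex[OF power_bracket[OF _ this, of 4]]
  show "4 ^ K \<le> P (14 * \<sigma>)" "P (14 * \<sigma>) < 4 ^ Suc K" by (simp_all add: K_def)
qed

lemma four_power_le: "k \<le> K \<Longrightarrow> 4 ^ k \<le> P (14 * \<sigma>)"
  using K(1) power_increasing[of k K "4::real"] by linarith

lemma sixteen_power_le: "k \<le> K \<Longrightarrow> 16 ^ k \<le> P (28 * \<sigma>)"
proof -
  assume "k \<le> K"
  then have "(4 ^ k) * (4 ^ k) \<le> P (28 * \<sigma>)" using four_power_le by (intro P_le_multI[of _ "14 * \<sigma>" _ "14 * \<sigma>"]) auto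
  then show ?thesis by (simp add: power_mult_distrib[symmetric])
qed

text \<open>For the upper bound, \<open>d ^ r\<close> is at most \<open>d ^ R k / d ^ \<mu>\<close>,
  with exponents \<open>1/2 + 15 * \<sigma>\<close> above and \<open>1/4 - 2 * \<sigma>\<close>
  below.\<close>

lemma radius:
  assumes "k \<le> K" "\<mu> \<le> r" "r + \<mu> \<le> R k"
  shows "P (1/4 - 2 * \<sigma>) \<le> d ^ r" "d ^ r \<le> P (1/4 + 17 * \<sigma>)"
proof -
  have "d ^ \<mu> \<le> d ^ r" using d assms by (intro power_increasing) auto
  then show "P (1/4 - 2 * \<sigma>) \<le> d ^ r" using \<mu> by linarith
  have "d ^ r * P (1/4 - 2 * \<sigma>) \<le> d ^ r * d ^ \<mu>" using \<mu> d by (intro mult_left_mono) auto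
  also have "\<dots> \<le> d ^ R k" using d assms by (simp add: power_add[symmetric] power_increasing)
  also have "\<dots> \<le> c0 * sqrt (real n) * 4 ^ k" using R(1) by (simp add: x_def)
  also have "\<dots> \<le> P (1/2 + 15 * \<sigma>)"
    using c0 P_half four_power_le[OF assms(1)]
    by (intro P_le_multI[of _ "\<sigma> + 1/2" _ "14 * \<sigma>"] P_le_multI[of _ \<sigma> _ "1/2"]) auto
  finally have "d ^ r * P (1/4 - 2 * \<sigma>) \<le> P (1/2 + 15 * \<sigma>)" .
  then have "d ^ r * P (1/4 - 2 * \<sigma>) * P (- (1/4 - 2 * \<sigma>)) \<le> P (1/2 + 15 * \<sigma>) * P (- (1/4 - 2 * \<sigma>))"
    by (intro mult_right_mono) auto
  moreover have "d ^ r * P (1/4 - 2 * \<sigma>) * P (- (1/4 - 2 * \<sigma>)) = d ^ r"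
    using n by (simp only: mult.assoc P_mult) simp
  moreover have "P (1/2 + 15 * \<sigma>) * P (- (1/4 - 2 * \<sigma>)) = P (1/4 + 17 * \<sigma>)"
    by (simp add: P_mult algebra_simps)
  ultimately show "d ^ r \<le> P (1/4 + 17 * \<sigma>)" by linarith
qed

abbreviation state :: "nat \<Rightarrow> nat \<times> nat \<times> nat set \<Rightarrow> bool" where
  "state \<equiv> state_at n E X d a2 R \<mu>"

text \<open>Small enough for the last team, yet large enough that any \<open>A\<close> exceeding it
  meets the size condition in \<open>access\<close>.\<close>

definition \<theta> :: real where "\<theta> = P (1/4 - 9 * \<sigma>)"

lemma last_state_small:
  assumes "state K (p, r, A)"
  shows "real (card A) \<le> \<theta>"
proof -
  have r: "\<mu> \<le> r" "r + \<mu> \<le> R K" and A: "real (card A) \<le> a2 * d ^ r / 16 ^ K"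
    using assms by (auto simp: state_at_def)
  have "real (card A) * P (28 * \<sigma>) \<le> real (card A) * (16 * 16 ^ K)"
  proof (rule mult_left_mono)
    have "P (28 * \<sigma>) = P (14 * \<sigma>) * P (14 * \<sigma>)" by (simp add: P_mult)
    also have "\<dots> \<le> 4 ^ Suc K * 4 ^ Suc K" using K(2) by (intro mult_mono) auto
    also have "\<dots> = 16 * 16 ^ K" by (simp add: power_mult_distrib[symmetric])
    finally show "P (28 * \<sigma>) \<le> 16 * 16 ^ K" .
  qed simp
  \<comment> \<open>The exponent is \<open>1/4 + 17 * \<sigma>\<close> for \<open>d ^ r\<close> and
    \<open>2 * \<sigma>\<close> for the constants; subtracting \<open>28 * \<sigma>\<close> leaves
    that of \<open>\<theta>\<close>.\<close>
  also have "\<dots> \<le> (16 * a2) * d ^ r" using A by (simp add: field_simps)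
  also have "\<dots> \<le> P (1/4 + 19 * \<sigma>)"
    using const_le pos radius[OF order_refl r]
    by (intro P_le_multI[of _ "2 * \<sigma>" _ "1/4 + 17 * \<sigma>"] P_le_multI[of _ \<sigma> _ \<sigma>]) auto
  also have "\<dots> = \<theta> * P (28 * \<sigma>)" by (simp add: P_mult \<theta>_def add.commute)
  finally show ?thesis by (rule mult_right_le_imp_le) simp
qed

lemma state_ball:
  assumes "k \<le> K" "p \<in> {..<n} - X" "1 \<le> r" "\<mu> \<le> r" "r + \<mu> \<le> R k"
  shows "card (nbhd E {p} (r - 1)) \<le> m"
  using assms radius by (intro ball_le_m) auto

section \<open>The last team\<close>

definition T :: nat where "T = (SOME r. d ^ r \<le> P (1/2 + 2 * \<sigma>) \<and> P (1/2 + 2 * \<sigma>) < d ^ Suc r)"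

lemma T: "d ^ T \<le> P (1/2 + 2 * \<sigma>)" "P (1/2 + \<sigma>) \<le> d ^ T"
proof -
  have "P 0 \<le> P (1/2 + 2 * \<sigma>)" using \<sigma> by (intro P_mono) auto
  then have "1 \<le> P (1/2 + 2 * \<sigma>)" using n by simp
  from someI_ex[OF power_bracket[OF _ this, of d]]
  have *: "d ^ T \<le> P (1/2 + 2 * \<sigma>)" "P (1/2 + 2 * \<sigma>) < d * d ^ T" using d by (simp_all add: T_def)
  show "d ^ T \<le> P (1/2 + 2 * \<sigma>)" by fact
  have "P \<sigma> * P (1/2 + \<sigma>) = P (1/2 + 2 * \<sigma>)" by (simp add: P_mult add.commute)
  also have "\<dots> \<le> d * d ^ T" using * by simp
  also have "\<dots> \<le> P \<sigma> * d ^ T" using d d_le by (intro mult_right_mono) auto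
  finally show "P (1/2 + \<sigma>) \<le> d ^ T" by (rule mult_left_le_imp_le) simp
qed

text \<open>Nonempty sets to which the expansion hypothesis applies at radius \<open>T\<close>; by
  \<open>log_le\<close> the size condition implies the one with the logarithm.\<close>

definition final_family :: "nat set set" where
  "final_family = {V. V \<noteq> {} \<and> (\<exists>v\<in>{..<n} - X. V \<subseteq> nbhd E {v} (T - 1) - X) \<and>
     real (card V) * d ^ T \<le> P (1 - \<sigma>)}"

lemma T_ge_2: "T \<ge> 2"
proof (rule ccontr)
  assume "\<not> T \<ge> 2"
  then have "d ^ T \<le> d ^ 1" using d by (intro power_increasing) auto
  then have "P (1/2 + \<sigma>) \<le> P \<sigma>" using T(2) d_le by simp
  moreover have "P \<sigma> < P (1/2 + \<sigma>)" by (intro P_less) auto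
  ultimately show False by linarith
qed

text \<open>The sphere around \<open>V\<close> has at least \<open>a1 * P \<sigma> * sqrt n\<close>
  vertices for each element of \<open>V\<close>. With \<open>sqrt n\<close> random cops the exponent
  in the union bound is therefore at least \<open>a1 * P \<sigma> - 1\<close>, and
  \<open>exp_small\<close> applies.\<close>

lemma exists_final_team:
  "\<exists>fin. length fin = nat \<lceil>sqrt (real n)\<rceil> \<and> set fin \<subseteq> {..<n} \<and>
     (\<forall>V\<in>final_family. card V \<le> card (set fin \<inter> sphere E V T))"
proof (rule exists_list_expanding[where \<theta> = "a1 * d ^ T"])
  show "n > 0" using n by simp
  show "{} \<notin> final_family" by (simp add: final_family_def)
  fix V assume V: "V \<in> final_family"
  then obtain v where v: "v \<in> {..<n} - X" "V \<subseteq> nbhd E {v} (T - 1) - X" "real (card V) * d ^ T \<le> P (1 - \<sigma>)"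
    by (auto simp: final_family_def)
  show Vn: "V \<subseteq> {..<n}" using v nbhd_subset[OF graph, of "{v}" "T - 1"] by auto
  show "sphere E V T \<subseteq> {..<n}" using order_trans[OF sphere_subset_nbhd nbhd_subset[OF graph Vn]] .
  have lt: "d ^ T < P (1/2 + \<delta>)" using T(1) P_less[of "1/2 + 2 * \<sigma>" "1/2 + \<delta>"] \<sigma> by linarith
  moreover have "d ^ (T - 1) \<le> d ^ T" using d by (intro power_increasing) auto
  ultimately have "a1 * real (card V) * d ^ T \<le> real (card (sphere E V T))"
    using v T_ge_2 log_le by (intro conjunct1[OF spheres[of v "T - 1" T V]]) auto
  then show "a1 * d ^ T * real (card V) \<le> real (card (sphere E V T))" by (simp add: mult_ac)
next
  have "a1 * P \<sigma> - 1 \<le> (a1 * d ^ T - 1) * real (nat \<lceil>sqrt (real n)\<rceil>) / real n"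
  proof -
    have a: "a1 * P \<sigma> * sqrt (real n) \<le> a1 * d ^ T"
      using T(2) P_mult[of \<sigma> "1/2"] pos P_half by (simp add: add.commute mult.assoc)
    have sq: "sqrt (real n) * sqrt (real n) = real n" by simp
    have s1: "1 \<le> sqrt (real n)" using n by simp
    have pre: "a1 * P \<sigma> \<ge> 1"
    proof (rule ccontr)
      assume "\<not> a1 * P \<sigma> \<ge> 1"
      then have "exp (1 - a1 * P \<sigma>) \<ge> 1" by simp
      then have "2 * real n ^ 3 * 1 \<le> 2 * real n ^ 3 * exp (1 - a1 * P \<sigma>)" by (intro mult_left_mono) auto
      moreover have "real n ^ 3 \<ge> 1" using n by simp
      ultimately show False using exp_small by linarith
    qed
    have "(a1 * P \<sigma> - 1) * real n = (a1 * P \<sigma> - 1) * sqrt (real n) * sqrt (real n)" using sq by (simp add: mult.assoc)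
    also have "\<dots> \<le> (a1 * d ^ T - 1) * real (nat \<lceil>sqrt (real n)\<rceil>)"
    proof (rule mult_mono)
      show "(a1 * P \<sigma> - 1) * sqrt (real n) \<le> a1 * d ^ T - 1" using a s1 left_diff_distrib[of "a1 * P \<sigma>" 1 "sqrt (real n)"] by linarith
      then show "0 \<le> a1 * d ^ T - 1" using pre s1 by (smt (verit) mult_nonneg_nonneg)
    qed (auto simp: real_nat_ceiling_ge)
    finally show ?thesis using n by (simp add: field_simps)
  qed
  then have "exp (- ((a1 * d ^ T - 1) * real (nat \<lceil>sqrt (real n)\<rceil>) / real n)) \<le> exp (1 - a1 * P \<sigma>)" by simp
  then have "2 * real n ^ 3 * exp (- ((a1 * d ^ T - 1) * real (nat \<lceil>sqrt (real n)\<rceil>) / real n))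
      \<le> 2 * real n ^ 3 * exp (1 - a1 * P \<sigma>)" by (intro mult_left_mono) auto
  then show "2 * real n ^ 3 * exp (- ((a1 * d ^ T - 1) * real (nat \<lceil>sqrt (real n)\<rceil>) / real n)) \<le> 1"
    using exp_small by linarith
qed

lemma small_state_wins:
  assumes fin: "\<forall>V\<in>final_family. card V \<le> card (set fin \<inter> sphere E V T)"
    and xs: "set xs = X" and k: "k \<le> K" and st: "state k (p, r, A)" and small: "real (card A) \<le> \<theta>"
    and cl: "reaches E cl ({..<n} - X)" "set cl \<subseteq> {..<n}" "length cl = m"
    and gs: "guards E gs (sphere E {p} r - A - X) (Suc r)"
  shows "cw_cops E (xs @ cl @ gs @ zs @ fin) p"
proof -
  have p: "p \<in> {..<n} - X" and r: "\<mu> \<le> r" "r + \<mu> \<le> R k" and A: "A \<subseteq> sphere E {p} r - X"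
    using st by (auto simp: state_at_def)
  have dr: "P (1/4 - 2 * \<sigma>) \<le> d ^ r" "d ^ r \<le> P (1/4 + 17 * \<sigma>)" using radius[OF k r] by auto
  \<comment> \<open>This leaves room for a second ball of positive radius \<open>s\<close> within
    the time \<open>T = r + s + 1\<close>, the last unit being the capturing move.\<close>
  have "r + 2 < T"
  proof (rule ccontr)
    assume "\<not> r + 2 < T"
    then have "d ^ T \<le> d ^ r * (d * d)"
      using d power_increasing[of T "r + 2" d] by (simp add: mult_ac)
    also have "\<dots> \<le> P (1/4 + 19 * \<sigma>)"
      using d d_le dr by (intro P_le_multI[of _ "1/4 + 17 * \<sigma>" _ "2 * \<sigma>"] P_le_multI[of _ \<sigma> _ \<sigma>]) auto
    finally have "P (1/2 + \<sigma>) \<le> P (1/4 + 19 * \<sigma>)" using T(2) by linarith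
    moreover have "P (1/4 + 19 * \<sigma>) < P (1/2 + \<sigma>)" using \<sigma> by (intro P_less) auto
    ultimately show False by linarith
  qed
  then obtain s where s: "T = r + Suc s" "s \<ge> 1" by (metis less_iff_Suc_add add_Suc_right add_Suc One_nat_def add_2_eq_Suc' le_add1 plus_1_eq_Suc)
  have ds: "d ^ s \<le> P (1/4 + 4 * \<sigma>)"
  proof -
    have "P (1/4 - 2 * \<sigma>) * d ^ s \<le> d ^ r * d ^ s" using dr d by (intro mult_right_mono) auto
    also have "\<dots> \<le> d ^ T" using d s by (simp add: power_add[symmetric] power_increasing)
    also have "\<dots> \<le> P (1/2 + 2 * \<sigma>)" by (rule T)
    also have "\<dots> = P (1/4 - 2 * \<sigma>) * P (1/4 + 4 * \<sigma>)" by (simp add: P_mult)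
    finally show ?thesis by (rule mult_left_le_imp_le) simp
  qed
  have ds_le: "d ^ s \<le> P (1/2)" "d ^ s \<le> P (1/4 + 17 * \<sigma>)"
    using ds P_mono[of "1/4 + 4 * \<sigma>" "1/2"] P_mono[of "1/4 + 4 * \<sigma>" "1/4 + 17 * \<sigma>"] \<sigma> by linarith+
  have sph: "sphere E {v} t \<subseteq> {..<n}" if "v < n" for v t
    using order_trans[OF sphere_subset_nbhd nbhd_subset[OF graph, of "{v}"]] that by simp
  have An: "A \<subseteq> {..<n} - X" using A sph[of p r] p by auto
  have finA: "finite A" using finite_subset[OF An] by simp
  define U where "U = (\<Union>v\<in>A. sphere E {v} s) - X"
  have Un: "U \<subseteq> {..<n}" using An sph unfolding U_def by blast
  have finU: "finite U" using finite_subset[OF Un] by simp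
  have "card U \<le> (\<Sum>v\<in>A. card (sphere E {v} s))"
  proof -
    have "card U \<le> card (\<Union>v\<in>A. sphere E {v} s)"
      unfolding U_def using finA An sph by (intro card_mono) (auto intro!: finite_subset[OF sph])
    then show ?thesis using card_UN_le[OF finA, of "\<lambda>v. sphere E {v} s"] by linarith
  qed
  then have "real (card U) \<le> (\<Sum>v\<in>A. real (card (sphere E {v} s)))" by (metis of_nat_le_iff of_nat_sum)
  also have "\<dots> \<le> (\<Sum>v\<in>A. a2 * d ^ s)"
    using An s ds_le by (intro sum_mono sphere_upper(2)) auto
  also have "\<dots> = real (card A) * (a2 * d ^ s)" by simp
  finally have cardU: "real (card U) \<le> real (card A) * (a2 * d ^ s)" .
  have "U \<subseteq> nbhd E {p} (T - 1) - X"
  proof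
    fix w assume "w \<in> U"
    then obtain v where "v \<in> A" "w \<in> sphere E {v} s" "w \<notin> X" by (auto simp: U_def)
    then have "v \<in> nbhd E {p} r" "w \<in> nbhd E {v} s" using A sphere_subset_nbhd by blast+
    then show "w \<in> nbhd E {p} (T - 1) - X" using nbhd_trans[of v E "{p}" r w s] \<open>w \<notin> X\<close> s by simp
  qed
  \<comment> \<open>The exponents of \<open>card A\<close>, \<open>a2\<close> and
    \<open>d ^ s\<close> add up to \<open>1/2 - 4 * \<sigma>\<close>, and that of
    \<open>d ^ T\<close> is \<open>1/2 + 2 * \<sigma>\<close>.\<close>
  moreover have "real (card U) * d ^ T \<le> P (1 - \<sigma>)"
  proof (rule P_le_multI[OF _ T(1), of _ "1/2 - 4 * \<sigma>"])
    have "real (card A) * (a2 * d ^ s) \<le> P (1/2 - 4 * \<sigma>)"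
      using small const_le ds pos unfolding \<theta>_def
      by (intro P_le_multI[of _ "1/4 - 9 * \<sigma>" _ "1/4 + 5 * \<sigma>"] P_le_multI[of _ \<sigma> _ "1/4 + 4 * \<sigma>"]) auto
    then show "real (card U) \<le> P (1/2 - 4 * \<sigma>)" using cardU by linarith
  qed (use \<sigma> in auto)
  ultimately have family: "V \<in> final_family" if "V \<subseteq> U" "V \<noteq> {}" for V
  proof -
    have "real (card V) * d ^ T \<le> real (card U) * d ^ T"
      using card_mono[OF finU that(1)] d by (intro mult_right_mono) auto
    then show ?thesis
      using that p \<open>U \<subseteq> nbhd E {p} (T - 1) - X\<close> \<open>real (card U) * d ^ T \<le> P (1 - \<sigma>)\<close>
      unfolding final_family_def by force
  qed
  have "guards E fin U T"
  proof (rule guards_if_hall[OF graph finU])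
    fix V assume "V \<subseteq> U"
    then show "card V \<le> card (set fin \<inter> sphere E V T)" using fin family by (cases "V = {}") auto
  qed
  then have "guards E (zs @ fin) ((\<Union>v\<in>A. sphere E {v} s) - X) (r + Suc s)"
    unfolding U_def s(1) by (rule guards_append)
  moreover have "1 \<le> r" using r \<mu>_ge_1 by linarith
  ultimately have "cw_cops E (xs @ cl @ gs @ (zs @ fin) @ []) p"
    using An A cl p s ds_le dr state_ball[OF k p _ r]
    by (intro final_capture[OF graph xs p _ s(2) _ cl(1,2) _ _ gs] ball_le_m[THEN order_trans]) auto
  then show ?thesis by simp
qed

section \<open>The random teams of the stages\<close>

definition c1 :: real where "c1 = a4 * min c0 (a5 / (a2\<^sup>2 * c0))"

lemma c1_pos: "c1 > 0"
  using pos c0(1) by (simp add: c1_def)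

text \<open>Both terms of the minimum in accessibility have order \<open>sqrt n * 4 ^ k\<close>: the
  power of \<open>d\<close> exceeds \<open>x k\<close> because its exponent is
  \<open>R k + 1\<close>, and the union of spheres has at most
  \<open>a2\<^sup>2 * x k / 16 ^ k\<close> elements. The two constants are combined in
  \<open>c1\<close>.\<close>

lemma state_access:
  assumes k: "k < K" and st: "state k (p, r, A)" and big: "\<theta> < real (card A)"
  defines "s \<equiv> R k - r"
  shows "\<exists>W Q. (\<forall>v\<in>A. real (card (sphere E {v} s)) \<le> a2 * d ^ s \<and>
                    real (card (sphere E {v} s \<inter> Q)) \<le> a2 * d ^ s / (2 * 16 ^ Suc k)) \<and>
         (\<forall>w\<in>(\<Union>v\<in>A. sphere E {v} s) - Q. \<forall>w'\<in>(\<Union>v\<in>A. sphere E {v} s) - Q.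
            w \<noteq> w' \<longrightarrow> W w \<inter> W w' = {}) \<and>
         (\<forall>w\<in>(\<Union>v\<in>A. sphere E {v} s) - Q. W w \<subseteq> {..<n} \<and> W w \<subseteq> nbhd E {w} (Suc (R k)) \<and>
            c1 * sqrt (real n) * 4 ^ k \<le> real (card (W w)))"
proof -
  have p: "p \<in> {..<n} - X" and r: "\<mu> \<le> r" "r + \<mu> \<le> R k" and A: "A \<subseteq> sphere E {p} r - X"
    and cardA: "real (card A) \<le> a2 * d ^ r / 16 ^ k"
    using st by (auto simp: state_at_def)
  have s: "\<mu> \<le> s" "s + \<mu> \<le> R k" "r + s = R k" using r by (auto simp: s_def)
  have kK: "k \<le> K" using k by simp
  have range: "P (1/4 - \<delta>) < (d + 1) * d ^ t" "(d + 1) * d ^ t < P (1/4 + \<delta>)"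
    if "\<mu> \<le> t" "t + \<mu> \<le> R k" for t
  proof -
    have "P (1/4 - \<delta>) \<le> 1 * d ^ t"
      using radius(1)[OF kK that] P_mono[of "1/4 - \<delta>" "1/4 - 2 * \<sigma>"] \<sigma> by simp
    also have "\<dots> < (d + 1) * d ^ t" using d by (intro mult_strict_right_mono) auto
    finally show "P (1/4 - \<delta>) < (d + 1) * d ^ t" .
    have "(d + 1) * d ^ t \<le> (16 * d) * d ^ t" using d by (intro mult_right_mono) auto
    also have "\<dots> \<le> P (1/4 + 19 * \<sigma>)"
      using d d_le const_le radius(2)[OF kK that]
      by (intro P_le_multI[of _ "2 * \<sigma>" _ "1/4 + 17 * \<sigma>"] P_le_multI[of _ \<sigma> _ \<sigma>]) auto
    also have "\<dots> < P (1/4 + \<delta>)" using \<sigma> by (intro P_less) auto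
    finally show "(d + 1) * d ^ t < P (1/4 + \<delta>)" .
  qed
  have sph: "sphere E {v} t \<subseteq> {..<n}" if "v < n" for v t
    using order_trans[OF sphere_subset_nbhd nbhd_subset[OF graph, of "{v}"]] that by simp
  have An: "A \<subseteq> {..<n} - X" using A sph[of p r] p by auto
  have finA: "finite A" using finite_subset[OF An] by simp
  define U where "U = (\<Union>v\<in>A. sphere E {v} s)"
  have finU: "finite U" unfolding U_def using finA An sph by (auto intro!: finite_subset[OF sph])
  have s1: "1 \<le> s" using s(1) \<mu>_ge_1 by linarith
  have ds: "d ^ s \<le> P (1/2)"
    using radius(2)[OF kK s(1,2)] P_mono[of "1/4 + 17 * \<sigma>" "1/2"] \<sigma> by linarith
  have spheres_A: "a1 * d ^ s \<le> real (card (sphere E {v} s))" "real (card (sphere E {v} s)) \<le> a2 * d ^ s"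
    if "v \<in> A" for v
    using sphere_upper[of v s] An that s1 ds by auto
  have "card U \<le> (\<Sum>v\<in>A. card (sphere E {v} s))" unfolding U_def by (rule card_UN_le[OF finA])
  then have "real (card U) \<le> (\<Sum>v\<in>A. real (card (sphere E {v} s)))" by (metis of_nat_le_iff of_nat_sum)
  also have "\<dots> \<le> (\<Sum>v\<in>A. a2 * d ^ s)" using spheres_A by (intro sum_mono) auto
  also have "\<dots> = real (card A) * (a2 * d ^ s)" by simp
  also have "\<dots> \<le> a2 * d ^ r / 16 ^ k * (a2 * d ^ s)" using cardA pos d by (intro mult_right_mono) auto
  also have "\<dots> = a2\<^sup>2 * d ^ R k / 16 ^ k" by (simp add: power2_eq_square power_add s(3)[symmetric])
  finally have cardU: "real (card U) \<le> a2\<^sup>2 * d ^ R k / 16 ^ k" .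
  have "real (card A) > 0" using big P_pos(1)[of "1/4 - 9 * \<sigma>"] unfolding \<theta>_def by linarith
  then obtain v where "v \<in> A" by (metis card_gt_0_iff ex_in_conv of_nat_0_less_iff)
  moreover have "0 < a1 * d ^ s" using pos d by simp
  ultimately have "0 < real (card (sphere E {v} s))" using spheres_A(1)[of v] by linarith
  moreover have "card (sphere E {v} s) \<le> card U" using \<open>v \<in> A\<close> finU unfolding U_def by (intro card_mono) auto
  ultimately have Upos: "0 < real (card U)" by linarith
  have x2: "x k * x k = c0\<^sup>2 * real n * 16 ^ k"
    by (simp add: x_def power2_eq_square power_mult_distrib[symmetric] mult_ac)
  have "d ^ R k * real (card U) \<le> d ^ R k * (a2\<^sup>2 * d ^ R k / 16 ^ k)"
    using cardU d by (intro mult_left_mono) auto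
  also have "\<dots> = a2\<^sup>2 / 16 ^ k * (d ^ R k * d ^ R k)" by simp
  also have "\<dots> \<le> a2\<^sup>2 / 16 ^ k * (x k * x k)"
    using R(1)[of k] d by (intro mult_left_mono mult_mono) (auto intro: order_trans[OF _ R(1)])
  also have "\<dots> = (a2\<^sup>2 * c0\<^sup>2) * real n" unfolding x2 by simp
  also have "\<dots> < a3 * real n" using c0(4) by (intro mult_strict_right_mono) auto
  finally have "d ^ (r + s) < a3 * real n / real (card U)"
    using Upos s(3) by (simp add: pos_less_divide_eq)
  moreover have "P (1/4 - \<delta>) < real (card A)"
    using big P_mono[of "1/4 - \<delta>" "1/4 - 9 * \<sigma>"] \<sigma> unfolding \<theta>_def by linarith
  ultimately obtain Q where Q: "\<forall>v\<in>A. real (card (sphere E {v} s \<inter> Q)) < P (1/4 - 2 * \<delta>)"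
    and acc: "accessible E n d (U - Q) (r + s + 1) a4 a5"
    using access[OF range[OF r] range[OF s(1,2)] p A] unfolding U_def by auto
  obtain W where W: "\<forall>w\<in>U - Q. \<forall>w'\<in>U - Q. w \<noteq> w' \<longrightarrow> W w \<inter> W w' = {}"
    "\<forall>w\<in>U - Q. W w \<subseteq> {..<n} \<and> W w \<subseteq> nbhd E {w} (r + s + 1) \<and>
       real (card (W w)) \<ge> a4 * min (d ^ (r + s + 1)) (a5 * real n / real (card (U - Q)))"
    using acc unfolding accessible_def by blast
  have "c1 * sqrt (real n) * 4 ^ k \<le> real (card (W w))" if w: "w \<in> U - Q" for w
  proof -
    have sq: "0 \<le> sqrt (real n) * 4 ^ k" by simp
    have Wpos: "0 < real (card (U - Q))" using w finU by (auto simp: card_gt_0_iff)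
    have "card (U - Q) \<le> card U" using finU by (intro card_mono) auto
    then have "real (card (U - Q)) \<le> a2\<^sup>2 * d ^ R k / 16 ^ k" using cardU by linarith
    also have "\<dots> \<le> a2\<^sup>2 * x k / 16 ^ k" using R(1)[of k] by (intro divide_right_mono mult_left_mono) auto
    finally have U_le: "real (card (U - Q)) \<le> a2\<^sup>2 * x k / 16 ^ k" .
    have "(a5 / (a2\<^sup>2 * c0)) * (sqrt (real n) * 4 ^ k) = a5 * real n / (a2\<^sup>2 * x k / 16 ^ k)"
    proof -
      have "(a5 / (a2\<^sup>2 * c0)) * (sqrt (real n) * 4 ^ k) * (a2\<^sup>2 * x k / 16 ^ k)
          = a5 * (sqrt (real n) * sqrt (real n)) * ((4 ^ k * 4 ^ k) / 16 ^ k)"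
        using pos c0(1) by (simp add: x_def)
      also have "\<dots> = a5 * real n" by (simp add: power_mult_distrib[symmetric])
      finally show ?thesis by (rule eq_divide_imp[rotated]) (use pos x_ge_1[of k] in auto)
    qed
    also have "\<dots> \<le> a5 * real n / real (card (U - Q))"
      using U_le Wpos pos less_le_trans[OF zero_less_one x_ge_1[of k]] by (intro divide_left_mono) auto
    finally have 2: "(a5 / (a2\<^sup>2 * c0)) * (sqrt (real n) * 4 ^ k) \<le> a5 * real n / real (card (U - Q))" .
    have 1: "c0 * (sqrt (real n) * 4 ^ k) \<le> d ^ (r + s + 1)"
      using R(2)[of k] s(3) by (simp add: x_def mult.assoc)
    have "min c0 (a5 / (a2\<^sup>2 * c0)) * (sqrt (real n) * 4 ^ k) \<le> c0 * (sqrt (real n) * 4 ^ k)"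
      "min c0 (a5 / (a2\<^sup>2 * c0)) * (sqrt (real n) * 4 ^ k) \<le> (a5 / (a2\<^sup>2 * c0)) * (sqrt (real n) * 4 ^ k)"
      by (rule mult_right_mono[OF _ sq], simp)+
    then have "min c0 (a5 / (a2\<^sup>2 * c0)) * (sqrt (real n) * 4 ^ k)
        \<le> min (d ^ (r + s + 1)) (a5 * real n / real (card (U - Q)))"
      using 1 2 by (intro min.boundedI) linarith+
    then have "a4 * (min c0 (a5 / (a2\<^sup>2 * c0)) * (sqrt (real n) * 4 ^ k)) \<le> real (card (W w))"
      using W(2) w pos mult_left_mono[of _ _ a4] by (meson less_imp_le order_trans)
    then show ?thesis by (simp add: c1_def mult.assoc)
  qed
  moreover have "real (card (sphere E {v} s \<inter> Q)) \<le> a2 * d ^ s / (2 * 16 ^ Suc k)" if "v \<in> A" for v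
  proof -
    \<comment> \<open>The exceptional vertices are negligible: \<open>2 * \<delta>\<close> is at
      least \<open>40 * \<sigma>\<close>, whereas the factor \<open>16 ^ k\<close> and the constant
      cost only \<open>29 * \<sigma>\<close>.\<close>
    have "P (1/4 - 2 * \<delta>) * (32 / a2 * 16 ^ k) \<le> P (1/4 - 40 * \<sigma>) * P (29 * \<sigma>)"
      using \<sigma> const_le pos sixteen_power_le[OF kK]
      by (intro mult_mono P_mono P_le_multI[of _ \<sigma> _ "28 * \<sigma>"]) auto
    also have "\<dots> \<le> P (1/4 - 2 * \<sigma>)" using \<sigma> unfolding P_mult by (intro P_mono) auto
    also have "\<dots> \<le> d ^ s" by (rule radius(1)[OF kK s(1,2)])
    finally have "P (1/4 - 2 * \<delta>) \<le> a2 * d ^ s / (2 * 16 ^ Suc k)" using pos by (simp add: field_simps)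
    then show ?thesis using Q that by fastforce
  qed
  ultimately show ?thesis
    using W spheres_A(2) s(3) unfolding U_def[symmetric]
    by (intro exI[of _ W] exI[of _ Q]) simp
qed

text \<open>The sizes of the teams decrease geometrically, although each accessible set still
  expects at least \<open>12 * 2 ^ k\<close> cops.\<close>

definition M :: "nat \<Rightarrow> nat" where "M k = nat \<lceil>12 / c1 * sqrt (real n) / 2 ^ k\<rceil>"

text \<open>The base of the power is at most \<open>exp (- 1)\<close>: the ratio of sphere size to
  \<open>\<beta>\<close> is at most \<open>exp (10 * Suc k)\<close>, which
  \<open>exp (- 12 * Suc k)\<close> outweighs. The exponent is at least \<open>P (1/8)\<close> and
  exceeds \<open>(k + 2) * ln n\<close> because \<open>K\<close> is at most
  \<open>ln n\<close>.\<close>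

lemma union_bound:
  assumes k: "k < K" and r: "\<mu> \<le> r" "r + \<mu> \<le> R k"
  defines "\<beta> \<equiv> a2 * d ^ r / (2 * 16 ^ Suc k)"
  shows "real n ^ (k + 2) * (exp 1 * (a2 * d ^ r) / real (nat \<lceil>\<beta>\<rceil>) *
         exp (- (c1 * sqrt (real n) * 4 ^ k * real (M k) / real n))) ^ nat \<lceil>\<beta>\<rceil> < 1"
proof -
  have kK: "k \<le> K" using k by simp
  define b where "b = nat \<lceil>\<beta>\<rceil>"
  have \<beta>: "\<beta> > 0" using pos d by (simp add: \<beta>_def)
  have b: "\<beta> \<le> real b" by (simp add: b_def real_nat_ceiling_ge)
  have "P (1/8) \<le> P (1/4 - 31 * \<sigma>)" using \<sigma> by (intro P_mono) auto
  moreover have "P (1/4 - 31 * \<sigma>) \<le> \<beta>"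
  proof -
    have "P (1/4 - 31 * \<sigma>) * (32 / a2 * 16 ^ k) \<le> P (1/4 - 31 * \<sigma>) * P (29 * \<sigma>)"
      using \<sigma> const_le pos sixteen_power_le[OF kK]
      by (intro mult_mono P_le_multI[of _ \<sigma> _ "28 * \<sigma>"]) auto
    also have "\<dots> \<le> P (1/4 - 2 * \<sigma>)" using \<sigma> unfolding P_mult by (intro P_mono) auto
    also have "\<dots> \<le> d ^ r" by (rule radius(1)[OF kK r])
    finally show ?thesis using pos by (simp add: field_simps \<beta>_def)
  qed
  ultimately have bP: "P (1/8) \<le> real b" using b by linarith
  have M: "12 * real (Suc k) \<le> c1 * sqrt (real n) * 4 ^ k * real (M k) / real n"
  proof -
    have "Suc k \<le> 2 ^ k" by (simp add: Suc_leI)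
    then have "real (Suc k) \<le> real (2 ^ k)" by (simp only: of_nat_le_iff)
    then have "12 * real (Suc k) \<le> 12 * 2 ^ k" by simp
    also have "\<dots> = 12 * ((2 ^ k * 2 ^ k) / 2 ^ k)" by simp
    also have "\<dots> = 12 * (4 ^ k / 2 ^ k)" by (simp only: power_mult_distrib[symmetric]) simp
    also have "\<dots> = c1 * (sqrt (real n) * sqrt (real n)) * 4 ^ k * (12 / c1 / 2 ^ k) / real n"
      using c1_pos by simp
    also have "\<dots> = c1 * sqrt (real n) * 4 ^ k * (12 / c1 * sqrt (real n) / 2 ^ k) / real n"
      by (simp only: mult_ac times_divide_eq_left times_divide_eq_right)
    also have "\<dots> \<le> c1 * sqrt (real n) * 4 ^ k * real (M k) / real n"
      using c1_pos by (intro divide_right_mono mult_left_mono) (auto simp: M_def real_nat_ceiling_ge)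
    finally show ?thesis .
  qed
  have inner: "exp 1 * (a2 * d ^ r) / real b * exp (- (c1 * sqrt (real n) * 4 ^ k * real (M k) / real n)) \<le> exp (- 1)"
  proof -
    have "a2 * d ^ r / real b \<le> a2 * d ^ r / \<beta>" using b \<beta> pos d by (intro divide_left_mono) auto
    also have "\<dots> = 2 * 16 ^ Suc k" using pos d by (simp add: \<beta>_def)
    also have "\<dots> \<le> 2 ^ Suc k * 16 ^ Suc k" by (intro mult_right_mono) auto
    also have "\<dots> = 32 ^ Suc k" by (simp only: power_mult_distrib[symmetric]) simp
    also have "\<dots> \<le> exp 10 ^ Suc k"
    proof (rule power_mono)
      have "(32::real) \<le> 2 ^ 10" by simp
      also have "\<dots> \<le> exp 1 ^ 10" using exp_ge_add_one_self[of 1] by (intro power_mono) auto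
      also have "\<dots> = exp 10" by (simp add: exp_of_nat_mult[symmetric])
      finally show "32 \<le> exp (10::real)" .
    qed simp
    also have "\<dots> = exp (10 * real (Suc k))" by (simp add: exp_of_nat_mult[symmetric] mult.commute del: power_Suc)
    finally have "a2 * d ^ r / real b \<le> exp (10 * real (Suc k))" .
    then have "exp 1 * (a2 * d ^ r / real b) * exp (- (c1 * sqrt (real n) * 4 ^ k * real (M k) / real n))
        \<le> exp 1 * exp (10 * real (Suc k)) * exp (- (12 * real (Suc k)))"
      using M pos d by (intro mult_mono) auto
    also have "\<dots> = exp (1 + 10 * real (Suc k) + - (12 * real (Suc k)))" by (simp only: exp_add)
    also have "\<dots> \<le> exp (- 1)" by simp
    finally show ?thesis by simp
  qed
  have "real K \<le> ln (real n)"
  proof -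
    have "exp (real K) = exp 1 ^ K" by (simp add: exp_of_nat_mult[symmetric])
    also have "\<dots> \<le> 4 ^ K" using exp_le by (intro power_mono) auto
    also have "\<dots> \<le> P 1" using K(1) P_mono[of "14 * \<sigma>" 1] \<sigma> by linarith
    finally have "exp (real K) \<le> real n" by simp
    then show ?thesis by (simp add: ln_ge_iff)
  qed
  then have "(real k + 2) * ln (real n) \<le> (ln (real n) + 2) * ln (real n)"
    using kK n by (intro mult_right_mono) auto
  then have "(real k + 2) * ln (real n) < real b" using log_small bP by linarith
  moreover have "real n ^ (k + 2) = exp ((real k + 2) * ln (real n))"
  proof -
    have "exp ((real k + 2) * ln (real n)) = exp (ln (real n)) ^ (k + 2)"
      by (subst exp_of_nat_mult[symmetric]) simp
    then show ?thesis by simp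
  qed
  ultimately have "real n ^ (k + 2) < exp (real b)" by simp
  have "(exp 1 * (a2 * d ^ r) / real b * exp (- (c1 * sqrt (real n) * 4 ^ k * real (M k) / real n))) ^ b
      \<le> exp (- 1) ^ b"
    using inner pos d by (intro power_mono) auto
  also have "\<dots> = exp (- real b)" by (simp add: exp_of_nat_mult[symmetric])
  finally have "real n ^ (k + 2) * (exp 1 * (a2 * d ^ r) / real b *
      exp (- (c1 * sqrt (real n) * 4 ^ k * real (M k) / real n))) ^ b \<le> real n ^ (k + 2) * exp (- real b)"
    by (intro mult_left_mono) auto
  also have "\<dots> < exp (real b) * exp (- real b)"
    using \<open>real n ^ (k + 2) < exp (real b)\<close> by (intro mult_strict_right_mono) auto
  also have "\<dots> = 1" by (simp add: exp_minus)
  finally show ?thesis unfolding b_def .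
qed

text \<open>The geometric series contributes a factor 2, and rounding up adds at most
  \<open>K\<close>, which is below \<open>sqrt n\<close>.\<close>

lemma sum_M_le: "(\<Sum>k<K. real (M k)) \<le> (24 / c1 + 1) * sqrt (real n)"
proof -
  have geo: "(\<Sum>k<j. 1 / 2 ^ k) \<le> (2::real)" for j :: nat
    using geometric_sum[of "1/2::real" j] by (simp add: power_divide)
  have "(\<Sum>k<K. real (M k)) \<le> (\<Sum>k<K. 12 / c1 * sqrt (real n) * (1 / 2 ^ k) + 1)"
  proof (rule sum_mono)
    fix k
    have "0 \<le> 12 / c1 * sqrt (real n) / 2 ^ k" using c1_pos by simp
    then show "real (M k) \<le> 12 / c1 * sqrt (real n) * (1 / 2 ^ k) + 1"
      using of_int_ceiling_le_add_one[of "12 / c1 * sqrt (real n) / 2 ^ k"] unfolding M_def by simp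
  qed
  also have "\<dots> = 12 / c1 * sqrt (real n) * (\<Sum>k<K. 1 / 2 ^ k) + real K"
    by (simp only: sum.distrib sum_distrib_left[symmetric]) simp
  also have "\<dots> \<le> 12 / c1 * sqrt (real n) * 2 + sqrt (real n)"
  proof (rule add_mono)
    show "12 / c1 * sqrt (real n) * (\<Sum>k<K. 1 / 2 ^ k) \<le> 12 / c1 * sqrt (real n) * 2"
      using geo c1_pos by (intro mult_left_mono) auto
    have "real K \<le> 4 ^ K"
      using of_nat_less_two_power[of K, where 'a = real] power_mono[of 2 "4::real" K] by linarith
    also have "\<dots> \<le> P (1/2)" using K(1) P_mono[of "14 * \<sigma>" "1/2"] \<sigma> by linarith
    finally show "real K \<le> sqrt (real n)" by (simp add: P_half)
  qed
  finally show ?thesis by (simp add: algebra_simps)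
qed

lemma exists_winning_list:
  "\<exists>cs. set cs \<subseteq> {..<n} \<and> (\<forall>r<n. cw_cops E cs r) \<and>
     real (length cs) \<le> real (card X) + (24 / c1 + 4) * sqrt (real n)"
proof (cases "{..<n} - X = {}")
  case True
  then have "cw_cops E (sorted_list_of_set X) r" if "r < n" for r
    using that X by (intro cops_caught) (auto simp: finite_subset[OF X])
  then show ?thesis
    using X c1_pos by (intro exI[of _ "sorted_list_of_set X"]) (auto simp: finite_subset[OF X])
next
  case False
  then obtain u where u: "u \<in> {..<n} - X" by blast
  define xs where "xs = sorted_list_of_set X"
  have xs: "set xs = X" "length xs = card X" using finite_subset[OF X] by (auto simp: xs_def)
  obtain fin where fin: "length fin = nat \<lceil>sqrt (real n)\<rceil>" "set fin \<subseteq> {..<n}"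
    "\<forall>V\<in>final_family. card V \<le> card (set fin \<inter> sphere E V T)"
    using exists_final_team by blast
  \<comment> \<open>The robber may start at any vertex outside \<open>X\<close>, and at first
    nothing of his sphere is guarded.\<close>
  define \<S> where "\<S> = (\<lambda>v. (v, \<mu>, sphere E {v} \<mu> - X)) ` ({..<n} - X)"
  have "card \<S> \<le> card ({..<n} - X)" unfolding \<S>_def by (intro card_image_le) auto
  also have "\<dots> \<le> card {..<n}" by (intro card_mono) auto
  finally have card: "card \<S> \<le> n ^ Suc 0" by simp
  have "state 0 s" if s: "s \<in> \<S>" for s
  proof -
    obtain v where v: "v \<in> {..<n} - X" "s = (v, \<mu>, sphere E {v} \<mu> - X)" using s unfolding \<S>_def by blast
    have fs: "finite (sphere E {v} \<mu>)"
      using v(1) nbhd_subset[OF graph, of "{v}" \<mu>] sphere_subset_nbhd[of E "{v}" \<mu>]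
      by (auto intro: finite_subset[of _ "{..<n}"])
    have R0: "\<mu> + \<mu> \<le> R 0" by (simp add: \<mu>_def)
    have "d ^ \<mu> \<le> P (1/2)"
      using radius(2)[OF le0 order_refl R0] P_mono[of "1/4 + 17 * \<sigma>" "1/2"] \<sigma> by linarith
    then have "real (card (sphere E {v} \<mu>)) \<le> a2 * d ^ \<mu>" by (rule sphere_upper(2)[OF v(1) \<mu>_ge_1])
    moreover have "card (sphere E {v} \<mu> - X) \<le> card (sphere E {v} \<mu>)" using fs by (intro card_mono) auto
    ultimately show ?thesis using v R0 by (auto simp: state_at_def)
  qed
  then have states: "\<And>s. s \<in> \<S> \<Longrightarrow> state 0 s" .
  have "\<exists>Zs. set Zs \<subseteq> {..<n} \<and> length Zs = (\<Sum>j\<in>{0..<K}. M j) \<and>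
    (\<forall>(p, r, A)\<in>\<S>. \<forall>cl gs. reaches E cl ({..<n} - X) \<longrightarrow> set cl \<subseteq> {..<n} \<longrightarrow> length cl = m \<longrightarrow>
       guards E gs (sphere E {p} r - A - X) (Suc r) \<longrightarrow> cw_cops E (xs @ cl @ gs @ Zs @ fin) p)"
  proof (rule exists_teams[where \<theta> = \<theta> and \<omega> = "\<lambda>k. c1 * sqrt (real n) * 4 ^ k",
        OF graph n_pos xs(1) \<mu>_ge_1 R_mono pos(2) _ _ small_state_wins[OF fin(3) xs(1)]
          state_access last_state_small union_bound le0 _ card states])
    show "d > 0" using d by simp
    show "finite \<S>" by (simp add: \<S>_def)
    show "card (nbhd E {p} (r - 1)) \<le> m"
      if "k < K" "p \<in> {..<n} - X" "1 \<le> r" "\<mu> \<le> r" "r + \<mu> \<le> R k" for k p r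
      using that by (intro state_ball[of k]) auto
  qed
  then obtain Zs where Zs: "set Zs \<subseteq> {..<n}" "length Zs = (\<Sum>j\<in>{0..<K}. M j)"
    and win: "\<forall>(p, r, A)\<in>\<S>. \<forall>cl gs. reaches E cl ({..<n} - X) \<longrightarrow> set cl \<subseteq> {..<n} \<longrightarrow> length cl = m \<longrightarrow>
       guards E gs (sphere E {p} r - A - X) (Suc r) \<longrightarrow> cw_cops E (xs @ cl @ gs @ Zs @ fin) p"
    by (elim exE conjE)
  \<comment> \<open>By connectivity the cleaning team may start at any one vertex outside
    \<open>X\<close>.\<close>
  define cl where "cl = replicate m u"
  have cl: "reaches E cl ({..<n} - X)" "set cl \<subseteq> {..<n}" "length cl = m"
    using u conn by (auto simp: reaches_def cl_def)
  have "cw_cops E (xs @ cl @ [] @ Zs @ fin) r" if "r < n" for r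
  proof (cases "r \<in> X")
    case True
    then show ?thesis using xs by (intro cops_caught) auto
  next
    case False
    then have "(r, \<mu>, sphere E {r} \<mu> - X) \<in> \<S>" using that unfolding \<S>_def by blast
    from bspec[OF win this] have *: "\<forall>cl gs. reaches E cl ({..<n} - X) \<longrightarrow> set cl \<subseteq> {..<n} \<longrightarrow> length cl = m \<longrightarrow>
       guards E gs (sphere E {r} \<mu> - (sphere E {r} \<mu> - X) - X) (Suc \<mu>) \<longrightarrow>
       cw_cops E (xs @ cl @ gs @ Zs @ fin) r" by (simp only: prod.case)
    have "sphere E {r} \<mu> - (sphere E {r} \<mu> - X) - X = {}" by blast
    then have "guards E [] (sphere E {r} \<mu> - (sphere E {r} \<mu> - X) - X) (Suc \<mu>)"
      by (simp only: guards_empty)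
    with * cl show ?thesis by blast
  qed
  moreover have "set (xs @ cl @ [] @ Zs @ fin) \<subseteq> {..<n}" using xs(1) X cl Zs fin by auto
  moreover have "real (length (xs @ cl @ [] @ Zs @ fin)) \<le> real (card X) + (24 / c1 + 4) * sqrt (real n)"
  proof -
    \<comment> \<open>The 4 in the bound is 1 for the cleaning team, 1 for rounding the sizes
      \<open>M k\<close>, and 2 for the last team.\<close>
    have 1: "real m \<le> sqrt (real n)" unfolding m_def by (simp add: of_nat_floor)
    have "real (nat \<lceil>sqrt (real n)\<rceil>) \<le> sqrt (real n) + 1"
      using of_int_ceiling_le_add_one[of "sqrt (real n)"] by simp
    also have "\<dots> \<le> 2 * sqrt (real n)" using n by simp
    finally have 2: "real (length fin) \<le> 2 * sqrt (real n)" using fin(1) by simp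
    have 3: "real (length Zs) \<le> (24 / c1 + 1) * sqrt (real n)"
      using sum_M_le Zs(2) by (simp add: atLeast0LessThan)
    have "real (length (xs @ cl @ [] @ Zs @ fin)) = real (card X) + real m + real (length Zs) + real (length fin)"
      using xs(2) cl(3) by simp
    also have "\<dots> \<le> real (card X) + sqrt (real n) + (24 / c1 + 1) * sqrt (real n) + 2 * sqrt (real n)"
      using 1 2 3 by linarith
    finally show ?thesis by (simp add: algebra_simps)
  qed
  ultimately show ?thesis by blast
qed

end

section \<open>Asymptotics\<close>

text \<open>The sign of \<open>J\<close> is arbitrary, so \<open>J\<close> is first replaced by a
  larger positive exponent; this is legitimate once \<open>ln x\<close> is at least 1.\<close>

lemma eventually_ln_powr_le:
  fixes J \<sigma> :: real
  assumes "\<sigma> > 0"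
  shows "eventually (\<lambda>x. ln x powr J \<le> x powr \<sigma>) at_top"
proof -
  define J' where "J' = \<bar>J\<bar> + 1"
  have J': "J' > 0" by (simp add: J'_def)
  have "eventually (\<lambda>x. ln x powr J' \<le> x powr \<sigma>) at_top" using assms J' by real_asymp
  moreover have "eventually (\<lambda>x::real. ln x \<ge> 1) at_top" by real_asymp
  ultimately show ?thesis
  proof eventually_elim
    case (elim x)
    have "ln x powr J \<le> ln x powr J'" using elim by (intro powr_mono) (auto simp: J'_def)
    then show ?case using elim by linarith
  qed
qed

lemma eventually_const_le_powr:
  fixes c \<sigma> :: real
  assumes "\<sigma> > 0"
  shows "eventually (\<lambda>x. c \<le> x powr \<sigma>) at_top"
  using assms by real_asymp

lemma eventually_cube_exp_le:
  fixes a \<sigma> :: real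
  assumes "\<sigma> > 0" "a > 0"
  shows "eventually (\<lambda>x. 2 * x ^ 3 * exp (1 - a * x powr \<sigma>) \<le> 1) at_top"
  using assms by real_asymp

lemma eventually_ln_square_less:
  "eventually (\<lambda>x::real. (ln x + 2) * ln x < x powr (1/8)) at_top"
  by real_asymp

theorem theorem3p1:
  fixes \<G> :: "nat \<Rightarrow> (nat \<Rightarrow> nat \<Rightarrow> bool) set"
    and d :: "nat \<Rightarrow> real"
  assumes graphs: "\<And>n E. E \<in> \<G> n \<Longrightarrow> graph_on n E"
    and d_ge: "\<And>n. d n \<ge> 2"
    and hyp: "\<exists>J \<delta> a1 a2 a3 a4 a5 CX N0 :: real.
      \<delta> > 0 \<and> a1 > 0 \<and> a2 > 0 \<and> a3 > 0 \<and> a4 > 0 \<and> a5 > 0 \<and> CX > 0 \<and>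
      (\<forall>n. real n \<ge> N0 \<longrightarrow> d n < ln (real n) powr J \<and>
        (\<forall>E\<in>\<G> n. \<exists>X \<subseteq> {..<n}. real (card X) \<le> CX * sqrt (real n) \<and>
          (\<forall>v\<in>{..<n} - X. \<forall>r r' :: nat. r \<ge> 1 \<longrightarrow> d n ^ r < real n powr (1/2 + \<delta>) \<longrightarrow>
              r' \<ge> 1 \<longrightarrow> d n ^ r' < real n powr (1/2 + \<delta>) \<longrightarrow>
              (\<forall>V' \<subseteq> nbhd E {v} r - X.
                 real (card V') * d n ^ r' \<le> real n / ln (real n) powr J \<longrightarrow>
                 a1 * real (card V') * d n ^ r' \<le> real (card (sphere E V' r')) \<and>
                 real (card (sphere E V' r')) \<le> a2 * real (card V') * d n ^ r')) \<and>
          (\<forall>r r' :: nat.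
              real n powr (1/4 - \<delta>) < (d n + 1) * d n ^ r \<longrightarrow>
              (d n + 1) * d n ^ r < real n powr (1/4 + \<delta>) \<longrightarrow>
              real n powr (1/4 - \<delta>) < (d n + 1) * d n ^ r' \<longrightarrow>
              (d n + 1) * d n ^ r' < real n powr (1/4 + \<delta>) \<longrightarrow>
              (\<forall>v\<in>{..<n} - X. \<forall>A \<subseteq> sphere E {v} r - X.
                 real (card A) > real n powr (1/4 - \<delta>) \<longrightarrow>
                 d n ^ (r + r') < a3 * real n / real (card (\<Union>a\<in>A. sphere E {a} r')) \<longrightarrow>
                 (\<exists>Q. (\<forall>a\<in>A. real (card (sphere E {a} r' \<inter> Q)) < real n powr (1/4 - 2*\<delta>)) \<and>
                      accessible E n (d n) ((\<Union>a\<in>A. sphere E {a} r') - Q) (r + r' + 1) a4 a5))) \<and>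
          (\<forall>u\<in>{..<n} - X. \<forall>w\<in>{..<n} - X. E\<^sup>*\<^sup>* u w)))"
  shows "\<exists>C N1 :: real. \<forall>n. real n \<ge> N1 \<longrightarrow>
           (\<forall>E\<in>\<G> n. real (cop_number n E) \<le> C * sqrt (real n))"
proof -
  obtain J \<delta> a1 a2 a3 a4 a5 CX N0 :: real
    where pos: "\<delta> > 0" "a1 > 0" "a2 > 0" "a3 > 0" "a4 > 0" "a5 > 0" "CX > 0"
      and main: "\<forall>n. real n \<ge> N0 \<longrightarrow> d n < ln (real n) powr J \<and>
        (\<forall>E\<in>\<G> n. \<exists>X \<subseteq> {..<n}. real (card X) \<le> CX * sqrt (real n) \<and>
          (\<forall>v\<in>{..<n} - X. \<forall>r r' :: nat. r \<ge> 1 \<longrightarrow> d n ^ r < real n powr (1/2 + \<delta>) \<longrightarrow>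
              r' \<ge> 1 \<longrightarrow> d n ^ r' < real n powr (1/2 + \<delta>) \<longrightarrow>
              (\<forall>V' \<subseteq> nbhd E {v} r - X.
                 real (card V') * d n ^ r' \<le> real n / ln (real n) powr J \<longrightarrow>
                 a1 * real (card V') * d n ^ r' \<le> real (card (sphere E V' r')) \<and>
                 real (card (sphere E V' r')) \<le> a2 * real (card V') * d n ^ r')) \<and>
          (\<forall>r r' :: nat.
              real n powr (1/4 - \<delta>) < (d n + 1) * d n ^ r \<longrightarrow>
              (d n + 1) * d n ^ r < real n powr (1/4 + \<delta>) \<longrightarrow>
              real n powr (1/4 - \<delta>) < (d n + 1) * d n ^ r' \<longrightarrow>
              (d n + 1) * d n ^ r' < real n powr (1/4 + \<delta>) \<longrightarrow>
              (\<forall>v\<in>{..<n} - X. \<forall>A \<subseteq> sphere E {v} r - X.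
                 real (card A) > real n powr (1/4 - \<delta>) \<longrightarrow>
                 d n ^ (r + r') < a3 * real n / real (card (\<Union>a\<in>A. sphere E {a} r')) \<longrightarrow>
                 (\<exists>Q. (\<forall>a\<in>A. real (card (sphere E {a} r' \<inter> Q)) < real n powr (1/4 - 2*\<delta>)) \<and>
                      accessible E n (d n) ((\<Union>a\<in>A. sphere E {a} r') - Q) (r + r' + 1) a4 a5))) \<and>
          (\<forall>u\<in>{..<n} - X. \<forall>w\<in>{..<n} - X. E\<^sup>*\<^sup>* u w))"
    using hyp by (elim exE conjE)
  define \<sigma> where "\<sigma> = min \<delta> (1/20) / 20"
  have \<sigma>: "\<sigma> > 0" "20 * \<sigma> \<le> \<delta>" "\<sigma> \<le> 1/400" using pos(1) by (auto simp: \<sigma>_def)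
  have "eventually (\<lambda>x. ln x powr J \<le> x powr \<sigma> \<and> a2 \<le> x powr \<sigma> \<and> 32 / a2 \<le> x powr \<sigma> \<and>
      16 \<le> x powr \<sigma> \<and> sqrt a3 / (2 * a2) \<le> x powr \<sigma> \<and> 2 * a2 / sqrt a3 \<le> x powr \<sigma> \<and>
      2 * x ^ 3 * exp (1 - a1 * x powr \<sigma>) \<le> 1 \<and> (ln x + 2) * ln x < x powr (1/8)) at_top"
    by (intro eventually_conj eventually_ln_powr_le eventually_const_le_powr eventually_cube_exp_le
        eventually_ln_square_less \<sigma>(1) pos)
  then obtain N1 where N1: "\<And>x. x \<ge> N1 \<Longrightarrow> ln x powr J \<le> x powr \<sigma> \<and> a2 \<le> x powr \<sigma> \<and> 32 / a2 \<le> x powr \<sigma> \<and>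
      16 \<le> x powr \<sigma> \<and> sqrt a3 / (2 * a2) \<le> x powr \<sigma> \<and> 2 * a2 / sqrt a3 \<le> x powr \<sigma> \<and>
      2 * x ^ 3 * exp (1 - a1 * x powr \<sigma>) \<le> 1 \<and> (ln x + 2) * ln x < x powr (1/8)"
    by (auto simp: eventually_at_top_linorder)
  \<comment> \<open>This is \<open>c1\<close> written out before \<open>n\<close> and the graph are
    fixed, which makes the final constant uniform.\<close>
  define c where "c = a4 * min (sqrt a3 / (2 * a2)) (a5 / (a2\<^sup>2 * (sqrt a3 / (2 * a2))))"
  define C where "C = CX + (24 / c + 4)"
  have "real (cop_number n E) \<le> C * sqrt (real n)"
    if n: "real n \<ge> max N0 (max N1 2)" and E: "E \<in> \<G> n" for n E
  proof -
    have N0: "real n \<ge> N0" and n2: "n > 1" using n by auto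
    have big: "ln (real n) powr J \<le> real n powr \<sigma>" "a2 \<le> real n powr \<sigma>" "32 / a2 \<le> real n powr \<sigma>"
      "16 \<le> real n powr \<sigma>" "sqrt a3 / (2 * a2) \<le> real n powr \<sigma>" "2 * a2 / sqrt a3 \<le> real n powr \<sigma>"
      "2 * real n ^ 3 * exp (1 - a1 * real n powr \<sigma>) \<le> 1" "(ln (real n) + 2) * ln (real n) < real n powr (1/8)"
      using N1[of "real n"] n by auto
    obtain X where X: "X \<subseteq> {..<n}" and cardX: "real (card X) \<le> CX * sqrt (real n)"
      and spheres: "\<forall>v\<in>{..<n} - X. \<forall>r r' :: nat. r \<ge> 1 \<longrightarrow> d n ^ r < real n powr (1/2 + \<delta>) \<longrightarrow>
              r' \<ge> 1 \<longrightarrow> d n ^ r' < real n powr (1/2 + \<delta>) \<longrightarrow>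
              (\<forall>V' \<subseteq> nbhd E {v} r - X.
                 real (card V') * d n ^ r' \<le> real n / ln (real n) powr J \<longrightarrow>
                 a1 * real (card V') * d n ^ r' \<le> real (card (sphere E V' r')) \<and>
                 real (card (sphere E V' r')) \<le> a2 * real (card V') * d n ^ r')"
      and access: "\<forall>r r' :: nat.
              real n powr (1/4 - \<delta>) < (d n + 1) * d n ^ r \<longrightarrow>
              (d n + 1) * d n ^ r < real n powr (1/4 + \<delta>) \<longrightarrow>
              real n powr (1/4 - \<delta>) < (d n + 1) * d n ^ r' \<longrightarrow>
              (d n + 1) * d n ^ r' < real n powr (1/4 + \<delta>) \<longrightarrow>
              (\<forall>v\<in>{..<n} - X. \<forall>A \<subseteq> sphere E {v} r - X.
                 real (card A) > real n powr (1/4 - \<delta>) \<longrightarrow>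
                 d n ^ (r + r') < a3 * real n / real (card (\<Union>a\<in>A. sphere E {a} r')) \<longrightarrow>
                 (\<exists>Q. (\<forall>a\<in>A. real (card (sphere E {a} r' \<inter> Q)) < real n powr (1/4 - 2*\<delta>)) \<and>
                      accessible E n (d n) ((\<Union>a\<in>A. sphere E {a} r') - Q) (r + r' + 1) a4 a5))"
      and conn: "\<forall>u\<in>{..<n} - X. \<forall>w\<in>{..<n} - X. E\<^sup>*\<^sup>* u w"
      using bspec[OF conjunct2[OF mp[OF spec[OF main] N0]] E] by (elim exE conjE)
    have lnJ: "ln (real n) powr J > 0" using n2 by simp
    have d_le: "d n \<le> real n powr \<sigma>" using mp[OF spec[OF main] N0] big(1) by linarith
    have log_le: "real n powr (1 - \<sigma>) \<le> real n / ln (real n) powr J"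
    proof -
      have "real n powr (1 - \<sigma>) = real n / real n powr \<sigma>" using n2 by (simp add: powr_diff)
      also have "\<dots> \<le> real n / ln (real n) powr J" using big(1) lnJ n2 by (intro divide_left_mono mult_pos_pos) auto
      finally show ?thesis .
    qed
    interpret sparse_expander n E X "d n" J \<delta> \<sigma> a1 a2 a3 a4 a5
    \<comment> \<open>Goals 9, 10 and 11 are the expansion, accessibility and connectivity
      hypotheses; the rest are facts at hand.\<close>
    proof (unfold_locales, goal_cases)
      case (9 v r r' V')
      show ?case by (rule spheres[rule_format, OF 9])
    next
      case (10 r r' v A)
      show ?case by (rule access[rule_format, OF 10])
    next
      case (11 u w)
      then show ?case using conn by blast
    qed (fact graphs[OF E] X d_ge pos \<sigma> n2 d_le log_le big)+
    obtain cs where cs: "set cs \<subseteq> {..<n}" "\<forall>r<n. cw_cops E cs r"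
      "real (length cs) \<le> real (card X) + (24 / c1 + 4) * sqrt (real n)"
      using exists_winning_list by blast
    have "cops_win n E (length cs)" using cs unfolding cops_win_def by blast
    then have "cop_number n E \<le> length cs" unfolding cop_number_def by (rule Least_le)
    then have "real (cop_number n E) \<le> CX * sqrt (real n) + (24 / c1 + 4) * sqrt (real n)"
      using cs(3) cardX by linarith
    moreover have "c1 = c" by (simp only: c1_def c0_def c_def)
    ultimately show ?thesis by (simp add: C_def algebra_simps)
  qed
  then show ?thesis by blast
qed

end
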